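(* Let $w\in F_r\setminus\{1\}$. Suppose a group $G$ acts by graph automorphisms, without inversions, on a simplicial tree $T$ and the action satisfies the stabilisation property. Let $\mathfrak C$ be the class of exactly those subgroups $C\le G$ that are the intersection of finitely many vertex stabilisers. Suppose that for every $z\in G$ and every $C\in\mathfrak C$ such that $C$ is normal in $H:=\langle C,z\rangle$, the group $H$ satisfies the $w$-law-power alternative. Then $G$ satisfies the $w$-law-power alternative.
   Context: $F_r=F(a_1,\dots,a_r)$ is the free group of rank $r$. For $w\in F_r$ and a group $G$, and $g_1,\dots,g_r\in G$, let $w(g_1,\dots,g_r)$ be the image of $w$ under the homomorphism $F_r\to G$ with $a_i\mapsto g_i$. $G$ satisfies the law $w$ if $w(g_1,\dots,g_r)=1$ for all $g_1,\dots,g_r\in G$. For $w\ne1$, $G$ satisfies the $w$-law-power alternative if for all $g,h\in G$ there exists an integer $n\ge1$ such that either $\langle g^n,h^n\rangle\cong F_2$ or $\langle g^n,h^n\rangle$ satisfies the law $w$. A simplicial tree is viewed as a metric space with every edge of length $1$. A geodesic in $T$ is an isometric embedding of an interval $I\subseteq\mathbb R$ into $T$ (segment, ray or line), identified with its image. The action has the stabilisation property if the following holds. Let $\{\gamma_n\}_{n\ge1}$ be any sequence of geodesics of $T$ that is monotonic for inclusion (either $\gamma_n\subset\gamma_{n+1}$ for all $n$, or $\gamma_{n+1}\subset\gamma_n$ for all $n$), let $\ell(\gamma_n)\in\mathbb R_{\ge0}\cup\{+\infty\}$ be the length of $\gamma_n$ and let $H_n\le G$ be the pointwise stabiliser of $\gamma_n$.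 If $\ell(\gamma_n)\to+\infty$, then there exists $N\ge1$ such that $H_n=H_{n+1}$ for all $n\ge N$. *)

theory Defs
  imports
    "HOL-Analysis.Analysis"
    "HOL-Algebra.Group_Action"
    "HOL-Algebra.Generated_Groups"
begin

section \<open>Free groups and laws\<close>

text \<open>
  The free group on a set \<open>X\<close> is realised by reduced words. The letter \<open>(a, True)\<close> stands for
  the generator \<open>a\<close>, and \<open>(a, False)\<close> for its inverse.
\<close>

type_synonym 'a letter = "'a \<times> bool"

definition letter_inv :: "'a letter \<Rightarrow> 'a letter"
  where "letter_inv x = (fst x, \<not> snd x)"

definition reduced_word :: "'a letter list \<Rightarrow> bool"
  where "reduced_word xs = successively (\<lambda>x y. y \<noteq> letter_inv x) xs"

definition push_letter :: "'a letter \<Rightarrow> 'a letter list \<Rightarrow> 'a letter list"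
  where "push_letter x ys =
    (case ys of [] \<Rightarrow> [x] | y # ys' \<Rightarrow> if y = letter_inv x then ys' else x # ys)"

definition free_group :: "'a set \<Rightarrow> 'a letter list monoid"
  where "free_group X =
    \<lparr>carrier = {xs. set xs \<subseteq> X \<times> UNIV \<and> reduced_word xs},
     mult = (\<lambda>xs ys. foldr push_letter xs ys),
     one = []\<rparr>"

text \<open>
  The value \<open>w(g)\<close>. The lemmas \<open>word_value_hom\<close>, \<open>word_value_generator\<close> and \<open>word_value_unique\<close>
  below identify it with the image of \<open>w\<close> under the unique homomorphism sending each generator
  \<open>a\<close> to \<open>g a\<close>.
\<close>

definition word_value :: "('g, 'm) monoid_scheme \<Rightarrow> ('a \<Rightarrow> 'g) \<Rightarrow> 'a letter list \<Rightarrow> 'g"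
  where "word_value K g w =
    foldr (\<lambda>x k. (if snd x then g (fst x) else inv\<^bsub>K\<^esub> (g (fst x))) \<otimes>\<^bsub>K\<^esub> k) w \<one>\<^bsub>K\<^esub>"

abbreviation free_group_rank :: "nat \<Rightarrow> nat letter list monoid"
  where "free_group_rank r \<equiv> free_group {1..r}"

definition satisfies_law :: "nat \<Rightarrow> nat letter list \<Rightarrow> ('g, 'm) monoid_scheme \<Rightarrow> bool"
  where "satisfies_law r w K \<longleftrightarrow>
    (\<forall>g. (\<forall>i\<in>{1..r}. g i \<in> carrier K) \<longrightarrow> word_value K g w = \<one>\<^bsub>K\<^esub>)"

definition law_power_alternative :: "nat \<Rightarrow> nat letter list \<Rightarrow> ('g, 'm) monoid_scheme \<Rightarrow> bool"
  where "law_power_alternative r w K \<longleftrightarrow>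
    (\<forall>g\<in>carrier K. \<forall>h\<in>carrier K. \<exists>n::nat. n \<ge> 1 \<and>
      (subgroup_generated K {g [^]\<^bsub>K\<^esub> n, h [^]\<^bsub>K\<^esub> n} \<cong> free_group_rank 2 \<or>
       satisfies_law r w (subgroup_generated K {g [^]\<^bsub>K\<^esub> n, h [^]\<^bsub>K\<^esub> n})))"

lemma letter_inv_inv [simp]: "letter_inv (letter_inv x) = x"
  by (simp add: letter_inv_def)

lemma letter_inv_eq_iff: "y = letter_inv x \<longleftrightarrow> x = letter_inv y"
  by auto

lemma reduced_push: "reduced_word ys \<Longrightarrow> reduced_word (push_letter x ys)"
  by (cases ys) (auto simp: reduced_word_def push_letter_def successively_Cons)

lemma reduced_foldr_push: "reduced_word ys \<Longrightarrow> reduced_word (foldr push_letter xs ys)"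
  by (induction xs) (auto simp: reduced_push)

lemma set_push: "set (push_letter x ys) \<subseteq> insert x (set ys)"
  by (cases ys) (auto simp: push_letter_def)

lemma set_foldr_push: "set (foldr push_letter xs ys) \<subseteq> set xs \<union> set ys"
  using set_push by (induction xs) fastforce+

lemma push_push_inv: "reduced_word ys \<Longrightarrow> push_letter x (push_letter (letter_inv x) ys) = ys"
  by (cases ys) (auto simp: reduced_word_def push_letter_def successively_Cons split: list.splits)

lemma foldr_push_push:
  assumes "reduced_word zs"
  shows "foldr push_letter (push_letter x ys) zs = push_letter x (foldr push_letter ys zs)"
proof (cases "\<exists>ys'. ys = letter_inv x # ys'")
  case True
  then show ?thesis
    using assms by (auto simp: push_letter_def[of x "letter_inv x # _"] push_push_inv reduced_foldr_push)
next
  case False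
  then have "push_letter x ys = x # ys"
    by (cases ys) (auto simp: push_letter_def)
  then show ?thesis by simp
qed

lemma foldr_push_assoc:
  "reduced_word zs \<Longrightarrow>
    foldr push_letter (foldr push_letter xs ys) zs = foldr push_letter xs (foldr push_letter ys zs)"
  by (induction xs) (auto simp: foldr_push_push)

lemma foldr_push_Nil: "reduced_word xs \<Longrightarrow> foldr push_letter xs [] = xs"
proof (induction xs)
  case (Cons x xs)
  then show ?case
    by (cases xs) (auto simp: reduced_word_def push_letter_def successively_Cons)
qed simp

lemma foldr_push_inverse:
  "reduced_word zs \<Longrightarrow> foldr push_letter (map letter_inv (rev xs)) (foldr push_letter xs zs) = zs"
proof (induction xs arbitrary: zs)
  case (Cons x xs)
  then show ?case
    using push_push_inv[of "foldr push_letter xs zs" "letter_inv x"]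
    by (simp add: reduced_foldr_push)
qed simp

lemma group_free_group: "group (free_group X)"
proof (rule groupI)
  fix x assume x: "x \<in> carrier (free_group X)"
  define y where "y = foldr push_letter (map letter_inv (rev x)) []"
  have "reduced_word y"
    unfolding y_def by (rule reduced_foldr_push) (simp add: reduced_word_def)
  moreover have "set y \<subseteq> X \<times> UNIV"
  proof -
    have "set y \<subseteq> letter_inv ` set x"
      using set_foldr_push[of "map letter_inv (rev x)" "[]"] by (simp add: y_def)
    then show ?thesis using x by (fastforce simp: free_group_def letter_inv_def)
  qed
  moreover have "foldr push_letter y x = []"
  proof -
    have "reduced_word x" using x by (simp add: free_group_def)
    then have "foldr push_letter y x = foldr push_letter (map letter_inv (rev x)) (foldr push_letter [] x)"
      unfolding y_def by (rule foldr_push_assoc)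
    also have "\<dots> = foldr push_letter (map letter_inv (rev x)) (foldr push_letter x [])"
      using \<open>reduced_word x\<close> by (simp add: foldr_push_Nil)
    also have "\<dots> = []" by (rule foldr_push_inverse) (simp add: reduced_word_def)
    finally show ?thesis .
  qed
  ultimately show "\<exists>y\<in>carrier (free_group X). y \<otimes>\<^bsub>free_group X\<^esub> x = \<one>\<^bsub>free_group X\<^esub>"
    by (intro bexI[of _ y]) (auto simp: free_group_def)
next
  fix x y assume "x \<in> carrier (free_group X)" "y \<in> carrier (free_group X)"
  then show "x \<otimes>\<^bsub>free_group X\<^esub> y \<in> carrier (free_group X)"
    using set_foldr_push[of x y] by (auto simp: free_group_def reduced_foldr_push)
qed (auto simp: free_group_def foldr_push_assoc reduced_word_def)

lemma word_value_closed:
  assumes "group K" "\<forall>a\<in>X. g a \<in> carrier K" "set w \<subseteq> X \<times> UNIV"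
  shows "word_value K g w \<in> carrier K"
proof -
  interpret group K by fact
  show ?thesis using assms(2,3) by (induction w) (auto simp: word_value_def)
qed

lemma word_value_push:
  assumes "group K" "\<forall>a\<in>X. g a \<in> carrier K" "set (x # w) \<subseteq> X \<times> UNIV"
  shows "word_value K g (push_letter x w) = word_value K g (x # w)"
proof (cases "\<exists>v. w = letter_inv x # v")
  case True
  interpret group K by fact
  obtain v where v: "w = letter_inv x # v" using True by blast
  have "word_value K g v \<in> carrier K"
    using word_value_closed[OF assms(1,2), of v] assms(3) v by auto
  moreover have "g (fst x) \<in> carrier K" using assms(2,3) by auto
  ultimately show ?thesis
    by (auto simp: v push_letter_def word_value_def letter_inv_def m_assoc[symmetric])
next
  case False
  then have "push_letter x w = x # w" by (cases w) (auto simp: push_letter_def)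
  then show ?thesis by simp
qed

lemma word_value_hom:
  assumes "group K" "\<forall>a\<in>X. g a \<in> carrier K"
  shows "word_value K g \<in> hom (free_group X) K"
proof -
  interpret group K by fact
  have "word_value K g (foldr push_letter u v) = word_value K g u \<otimes>\<^bsub>K\<^esub> word_value K g v"
    if "set u \<subseteq> X \<times> UNIV" "set v \<subseteq> X \<times> UNIV" for u v
    using that(1)
  proof (induction u)
    case Nil
    then show ?case
      using word_value_closed[OF assms that(2)] by (simp add: word_value_def)
  next
    case (Cons x u)
    have s: "set (x # foldr push_letter u v) \<subseteq> X \<times> UNIV"
      using Cons.prems that(2) set_foldr_push[of u v] by auto
    have c: "word_value K g u \<in> carrier K" "word_value K g v \<in> carrier K"
      using word_value_closed[OF assms] Cons.prems that(2) by auto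
    have "g (fst x) \<in> carrier K" using assms(2) Cons.prems by auto
    have step: "word_value K g (x # w) =
        (if snd x then g (fst x) else inv\<^bsub>K\<^esub> (g (fst x))) \<otimes>\<^bsub>K\<^esub> word_value K g w" for w
      by (simp add: word_value_def)
    have "word_value K g (foldr push_letter (x # u) v) = word_value K g (x # foldr push_letter u v)"
      using word_value_push[OF assms s] by simp
    also have "\<dots> = word_value K g (x # u) \<otimes>\<^bsub>K\<^esub> word_value K g v"
      using Cons c \<open>g (fst x) \<in> carrier K\<close> by (simp add: step m_assoc)
    finally show ?case .
  qed
  then show ?thesis
    using word_value_closed[OF assms] by (auto simp: hom_def free_group_def)
qed

lemma word_value_generator:
  assumes "group K" "g a \<in> carrier K"
  shows "word_value K g [(a, True)] = g a"
  using assms by (simp add: word_value_def group.is_monoid)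

lemma word_value_unique:
  assumes "group K" "f \<in> hom (free_group X) K" "\<forall>a\<in>X. f [(a, True)] = g a"
    and "w \<in> carrier (free_group X)"
  shows "f w = word_value K g w"
  using assms(4)
proof (induction w)
  case Nil
  have "f \<one>\<^bsub>free_group X\<^esub> = \<one>\<^bsub>K\<^esub>"
    using hom_one[OF assms(2) group_free_group assms(1)] .
  then show ?case by (simp add: free_group_def word_value_def)
next
  case (Cons x w)
  have w: "w \<in> carrier (free_group X)" and x: "fst x \<in> X"
    using Cons.prems by (auto simp: free_group_def reduced_word_def successively_Cons)
  have gen: "[(fst x, b)] \<in> carrier (free_group X)" for b
    using x by (auto simp: free_group_def reduced_word_def)
  have "[(fst x, False)] = inv\<^bsub>free_group X\<^esub> [(fst x, True)]"
    by (rule group.inv_equality[OF group_free_group, symmetric, OF _ gen gen])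
      (simp add: free_group_def push_letter_def letter_inv_def)
  then have "f [(fst x, False)] = inv\<^bsub>K\<^esub> (g (fst x))"
    using group_hom.hom_inv[of "free_group X" K f "[(fst x, True)]"] gen assms x
    by (simp add: group_hom_def group_hom_axioms_def group_free_group)
  then have fx: "f [x] = (if snd x then g (fst x) else inv\<^bsub>K\<^esub> (g (fst x)))"
    using assms(3) x by (cases x) auto
  have "reduced_word (x # w)" using Cons.prems by (simp add: free_group_def)
  then have "foldr push_letter [x] w = x # w"
    by (cases w) (auto simp: push_letter_def reduced_word_def successively_Cons)
  then have "x # w = [x] \<otimes>\<^bsub>free_group X\<^esub> w" by (simp add: free_group_def)
  then have "f (x # w) = f [x] \<otimes>\<^bsub>K\<^esub> f w"
    using hom_mult[OF assms(2), of "[x]" w] gen[of "snd x"] w by simp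
  then show ?case using Cons.IH[OF w] fx by (simp add: word_value_def)
qed


section \<open>Simplicial trees and their geometric realisation\<close>

definition is_circuit :: "'v set set \<Rightarrow> 'v list \<Rightarrow> bool"
  where "is_circuit E xs \<longleftrightarrow>
    length xs \<ge> 3 \<and> distinct xs \<and> successively (\<lambda>u v. {u, v} \<in> E) xs \<and> {last xs, hd xs} \<in> E"

locale simplicial_tree =
  fixes V :: "'v set" and E :: "'v set set"
  assumes nonempty: "V \<noteq> {}"
    and edges: "e \<in> E \<Longrightarrow> e \<subseteq> V \<and> card e = 2"
    and connected: "u \<in> V \<Longrightarrow> v \<in> V \<Longrightarrow>
      \<exists>xs. xs \<noteq> [] \<and> hd xs = u \<and> last xs = v \<and> successively (\<lambda>x y. {x, y} \<in> E) xs"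
    and no_circuit: "\<not> is_circuit E xs"

text \<open>Points of the realisation are given by their barycentric coordinates.\<close>

definition tree_cells :: "'v set \<Rightarrow> 'v set set \<Rightarrow> 'v set set"
  where "tree_cells V E = (\<lambda>v. {v}) ` V \<union> E"

definition closed_cell :: "'v set \<Rightarrow> ('v \<Rightarrow> real) set"
  where "closed_cell \<sigma> = {x. (\<forall>v. 0 \<le> x v) \<and> (\<forall>v. v \<notin> \<sigma> \<longrightarrow> x v = 0) \<and> sum x \<sigma> = 1}"

definition realisation :: "'v set \<Rightarrow> 'v set set \<Rightarrow> ('v \<Rightarrow> real) set"
  where "realisation V E = (\<Union>\<sigma>\<in>tree_cells V E. closed_cell \<sigma>)"

text \<open>
  \<open>pl_path V E x l y\<close> says that some piecewise linear path from \<open>x\<close> to \<open>y\<close> has length \<open>l\<close>.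
  On an edge \<open>{u, v}\<close> we have \<open>x v = 1 - x u\<close>, so half the \<open>l\<^sup>1\<close>-distance of the coordinates is
  \<open>\<bar>x u - y u\<bar>\<close>: this identifies the edge with the unit interval.
\<close>

inductive pl_path :: "'v set \<Rightarrow> 'v set set \<Rightarrow> ('v \<Rightarrow> real) \<Rightarrow> real \<Rightarrow> ('v \<Rightarrow> real) \<Rightarrow> bool"
  for V E where
    refl: "x \<in> realisation V E \<Longrightarrow> pl_path V E x 0 x"
  | step: "\<lbrakk>\<sigma> \<in> tree_cells V E; x \<in> closed_cell \<sigma>; y \<in> closed_cell \<sigma>; pl_path V E y l z\<rbrakk>
      \<Longrightarrow> pl_path V E x ((\<Sum>v\<in>\<sigma>. \<bar>x v - y v\<bar>) / 2 + l) z"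

definition tree_dist :: "'v set \<Rightarrow> 'v set set \<Rightarrow> ('v \<Rightarrow> real) \<Rightarrow> ('v \<Rightarrow> real) \<Rightarrow> real"
  where "tree_dist V E x y = Inf {l. pl_path V E x l y}"

definition isometric_embedding ::
    "'v set \<Rightarrow> 'v set set \<Rightarrow> real set \<Rightarrow> (real \<Rightarrow> 'v \<Rightarrow> real) \<Rightarrow> bool"
  where "isometric_embedding V E I c \<longleftrightarrow>
    c ` I \<subseteq> realisation V E \<and> (\<forall>s\<in>I. \<forall>t\<in>I. tree_dist V E (c s) (c t) = \<bar>s - t\<bar>)"

text \<open>
  The closed nonempty intervals are exactly the domains of segments (possibly reduced to a point),
  rays and lines.
\<close>

definition is_geodesic ::
    "'v set \<Rightarrow> 'v set set \<Rightarrow> real set \<Rightarrow> (real \<Rightarrow> 'v \<Rightarrow> real) \<Rightarrow> bool"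
  where "is_geodesic V E I c \<longleftrightarrow>
    is_interval I \<and> closed I \<and> I \<noteq> {} \<and> isometric_embedding V E I c"

context simplicial_tree
begin

lemma finite_cell: "\<sigma> \<in> tree_cells V E \<Longrightarrow> finite \<sigma>"
  using edges by (force simp: tree_cells_def intro: card_ge_0_finite)

lemma cell_subset: "\<sigma> \<in> tree_cells V E \<Longrightarrow> \<sigma> \<subseteq> V"
  using edges by (auto simp: tree_cells_def)

lemma pl_path_in: "pl_path V E x l y \<Longrightarrow> x \<in> realisation V E \<and> y \<in> realisation V E"
  by (induction rule: pl_path.induct) (auto simp: realisation_def)

lemma pl_path_trans:
  "pl_path V E x l y \<Longrightarrow> pl_path V E y m z \<Longrightarrow> pl_path V E x (l + m) z"
proof (induction rule: pl_path.induct)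
  case (step \<sigma> x y l z')
  then show ?case
    using pl_path.step[of \<sigma> V E x y "l + m" z] by (simp add: add.assoc)
qed simp

lemma pl_path_cell:
  assumes "\<sigma> \<in> tree_cells V E" "x \<in> closed_cell \<sigma>" "y \<in> closed_cell \<sigma>"
  shows "pl_path V E x ((\<Sum>v\<in>\<sigma>. \<bar>x v - y v\<bar>) / 2) y"
proof -
  have "y \<in> realisation V E" using assms by (auto simp: realisation_def)
  then show ?thesis using pl_path.step[OF assms pl_path.refl] by simp
qed

lemma pl_path_sym: "pl_path V E x l y \<Longrightarrow> pl_path V E y l x"
proof (induction rule: pl_path.induct)
  case (step \<sigma> x y l z)
  have "pl_path V E y ((\<Sum>v\<in>\<sigma>. \<bar>x v - y v\<bar>) / 2) x"
    using pl_path_cell[OF step(1,3,2)] by (simp add: abs_minus_commute)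
  from pl_path_trans[OF step(5) this] show ?case by (simp add: add.commute)
qed (rule pl_path.refl)

lemma cell_coord_le:
  assumes "\<sigma> \<in> tree_cells V E" "x \<in> closed_cell \<sigma>" "y \<in> closed_cell \<sigma>"
  shows "\<bar>x a - y a\<bar> \<le> (\<Sum>v\<in>\<sigma>. \<bar>x v - y v\<bar>) / 2"
proof (cases "a \<in> \<sigma>")
  case True
  note fin = finite_cell[OF assms(1)]
  have "sum x \<sigma> = sum y \<sigma>" using assms by (simp add: closed_cell_def)
  then have "x a - y a = - (\<Sum>v\<in>\<sigma> - {a}. x v - y v)"
    using fin True by (simp add: sum.remove sum_subtractf)
  then have "\<bar>x a - y a\<bar> \<le> (\<Sum>v\<in>\<sigma> - {a}. \<bar>x v - y v\<bar>)"
    by (metis abs_minus_cancel sum_abs)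
  then show ?thesis using fin True by (simp add: sum.remove)
next
  case False
  then show ?thesis using assms by (simp add: closed_cell_def sum_nonneg)
qed

lemma pl_path_coord_le: "pl_path V E x l y \<Longrightarrow> \<bar>x a - y a\<bar> \<le> l"
proof (induction rule: pl_path.induct)
  case (step \<sigma> x y l z)
  then show ?case using cell_coord_le[OF step(1-3), of a] by linarith
qed simp

lemma vertex_in_cell: "\<sigma> \<in> tree_cells V E \<Longrightarrow> v \<in> \<sigma> \<Longrightarrow> indicator {v} \<in> closed_cell \<sigma>"
  using finite_cell[of \<sigma>] by (auto simp: closed_cell_def indicator_def)

lemma pl_path_vertices:
  assumes "u \<in> V" "v \<in> V"
  shows "\<exists>l. pl_path V E (indicator {u}) l (indicator {v})"
proof -
  obtain xs where "xs \<noteq> []" "hd xs = u" "last xs = v"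
      "successively (\<lambda>x y. {x, y} \<in> E) xs"
    using connected[OF assms] by blast
  then show ?thesis using assms(1)
  proof (induction xs arbitrary: u)
    case (Cons x xs)
    show ?case
    proof (cases xs)
      case Nil
      then have "u = v" using Cons.prems by simp
      moreover have "indicator {u} \<in> realisation V E"
        using vertex_in_cell[of "{u}" u] Cons.prems by (auto simp: realisation_def tree_cells_def)
      ultimately show ?thesis using pl_path.refl by blast
    next
      case (Cons y ys)
      then have e: "{u, y} \<in> E" using Cons.prems by simp
      then have "y \<in> V" using edges by blast
      then obtain l where l: "pl_path V E (indicator {y}) l (indicator {v})"
        using Cons.IH[of y] Cons.prems Cons by auto
      have c: "{u, y} \<in> tree_cells V E" using e by (simp add: tree_cells_def)
      show ?thesis
        using pl_path.step[OF c vertex_in_cell[OF c] vertex_in_cell[OF c] l] by blast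
    qed
  qed simp
qed

lemma cell_nonempty: "\<sigma> \<in> tree_cells V E \<Longrightarrow> \<sigma> \<noteq> {}"
  using edges by (force simp: tree_cells_def)

lemma pl_path_exists:
  assumes "x \<in> realisation V E" "y \<in> realisation V E"
  shows "\<exists>l. pl_path V E x l y"
proof -
  have *: "\<exists>u\<in>V. \<exists>l. pl_path V E x l (indicator {u})" if x: "x \<in> realisation V E" for x
  proof -
    obtain \<sigma> where s: "\<sigma> \<in> tree_cells V E" "x \<in> closed_cell \<sigma>"
      using x by (auto simp: realisation_def)
    obtain u where "u \<in> \<sigma>" using cell_nonempty[OF s(1)] by blast
    then show ?thesis
      using pl_path_cell[OF s vertex_in_cell[OF s(1)]] cell_subset[OF s(1)] by blast
  qed
  obtain u l where u: "u \<in> V" "pl_path V E x l (indicator {u})" using *[OF assms(1)] by blast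
  obtain v m where v: "v \<in> V" "pl_path V E y m (indicator {v})" using *[OF assms(2)] by blast
  obtain k where "pl_path V E (indicator {u}) k (indicator {v})"
    using pl_path_vertices u v by blast
  then show ?thesis using u v pl_path_trans pl_path_sym by blast
qed

lemma pl_path_bdd_below: "bdd_below {l. pl_path V E x l y}"
  using pl_path_coord_le[of x _ y undefined] by (intro bdd_belowI[of _ 0]) force

lemma tree_dist_le: "pl_path V E x l y \<Longrightarrow> tree_dist V E x y \<le> l"
  unfolding tree_dist_def by (intro cInf_lower pl_path_bdd_below) simp

lemma tree_dist_coord_le:
  assumes "x \<in> realisation V E" "y \<in> realisation V E"
  shows "\<bar>x a - y a\<bar> \<le> tree_dist V E x y"
  unfolding tree_dist_def
  using pl_path_exists[OF assms] pl_path_coord_le by (intro cInf_greatest) auto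

lemma tree_dist_edge:
  assumes "{u, v} \<in> E" "x \<in> closed_cell {u, v}" "y \<in> closed_cell {u, v}"
  shows "tree_dist V E x y = \<bar>x u - y u\<bar>"
proof -
  have c: "{u, v} \<in> tree_cells V E" using assms(1) by (simp add: tree_cells_def)
  have "u \<noteq> v" using edges[OF assms(1)] by auto
  have "x u - y u = y v - x v" using assms(2,3) \<open>u \<noteq> v\<close> by (simp add: closed_cell_def)
  then have "tree_dist V E x y \<le> \<bar>x u - y u\<bar>"
    using tree_dist_le[OF pl_path_cell[OF c assms(2,3)]] \<open>u \<noteq> v\<close> by simp
  moreover have "\<bar>x u - y u\<bar> \<le> tree_dist V E x y"
    using assms c by (intro tree_dist_coord_le) (auto simp: realisation_def)
  ultimately show ?thesis by simp
qed

lemma tree_dist_sym: "tree_dist V E x y = tree_dist V E y x"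
proof -
  have "pl_path V E x l y = pl_path V E y l x" for l using pl_path_sym by blast
  then show ?thesis by (simp add: tree_dist_def)
qed

lemma tree_dist_zero_iff:
  assumes "x \<in> realisation V E" "y \<in> realisation V E"
  shows "tree_dist V E x y = 0 \<longleftrightarrow> x = y"
proof
  assume "tree_dist V E x y = 0"
  then have "x a = y a" for a using tree_dist_coord_le[OF assms, of a] by simp
  then show "x = y" by (rule ext)
next
  assume "x = y"
  then show "tree_dist V E x y = 0"
    using tree_dist_le[OF pl_path.refl[OF assms(1)]] tree_dist_coord_le[OF assms, of undefined]
    by simp
qed

lemma tree_dist_triangle:
  assumes "x \<in> realisation V E" "y \<in> realisation V E" "z \<in> realisation V E"
  shows "tree_dist V E x z \<le> tree_dist V E x y + tree_dist V E y z"
proof -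
  have "tree_dist V E x z - m \<le> tree_dist V E x y" if m: "pl_path V E y m z" for m
    unfolding tree_dist_def[of V E x y]
  proof (rule cInf_greatest)
    show "{l. pl_path V E x l y} \<noteq> {}" using pl_path_exists[OF assms(1,2)] by blast
    fix l assume "l \<in> {l. pl_path V E x l y}"
    then show "tree_dist V E x z - m \<le> l"
      using tree_dist_le[OF pl_path_trans[OF _ m]] by fastforce
  qed
  then have "tree_dist V E x z - tree_dist V E x y \<le> tree_dist V E y z"
    unfolding tree_dist_def[of V E y z]
    using pl_path_exists[OF assms(2,3)] by (intro cInf_greatest) (auto simp: algebra_simps)
  then show ?thesis by simp
qed

text \<open>
  The locale \<open>Metric_space\<close> constrains the distance function outside the carrier too, where
  \<open>tree_dist\<close> is the infimum of the empty set.
\<close>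

lemma Metric_space_realisation:
  "Metric_space (realisation V E)
    (\<lambda>x y. if x \<in> realisation V E \<and> y \<in> realisation V E then tree_dist V E x y else 0)"
proof
  show "0 \<le> (if x \<in> realisation V E \<and> y \<in> realisation V E then tree_dist V E x y else 0)" for x y
    using tree_dist_coord_le[of x y undefined] by (auto intro: order_trans[OF abs_ge_zero])
qed (auto simp: tree_dist_sym tree_dist_zero_iff tree_dist_triangle)

end


section \<open>Actions on trees\<close>

definition acts_by_graph_automorphisms ::
    "('g, 'm) monoid_scheme \<Rightarrow> 'v set \<Rightarrow> 'v set set \<Rightarrow> ('g \<Rightarrow> 'v \<Rightarrow> 'v) \<Rightarrow> bool"
  where "acts_by_graph_automorphisms G V E \<phi> \<longleftrightarrow>
    group_action G V \<phi> \<and>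
    (\<forall>g\<in>carrier G. \<forall>u\<in>V. \<forall>v\<in>V. {\<phi> g u, \<phi> g v} \<in> E \<longleftrightarrow> {u, v} \<in> E)"

definition without_inversions ::
    "('g, 'm) monoid_scheme \<Rightarrow> 'v set set \<Rightarrow> ('g \<Rightarrow> 'v \<Rightarrow> 'v) \<Rightarrow> bool"
  where "without_inversions G E \<phi> \<longleftrightarrow>
    \<not> (\<exists>g\<in>carrier G. \<exists>u v. {u, v} \<in> E \<and> \<phi> g u = v \<and> \<phi> g v = u)"

text \<open>The action on the realisation, extending the action on vertices linearly on each edge.\<close>

definition realised_action ::
    "('g, 'm) monoid_scheme \<Rightarrow> 'v set \<Rightarrow> ('g \<Rightarrow> 'v \<Rightarrow> 'v) \<Rightarrow> 'g \<Rightarrow> ('v \<Rightarrow> real) \<Rightarrow> ('v \<Rightarrow> real)"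
  where "realised_action G V \<phi> g x = (\<lambda>v. if v \<in> V then x (\<phi> (inv\<^bsub>G\<^esub> g) v) else 0)"

lemma realised_action_vertex:
  assumes "group_action G V \<phi>" "g \<in> carrier G" "u \<in> V"
  shows "realised_action G V \<phi> g (indicator {u}) = indicator {\<phi> g u}"
proof -
  interpret group_action G V \<phi> by fact
  interpret group_hom G "BijGroup V" \<phi> by (rule group_hom)
  have "\<phi> (inv\<^bsub>G\<^esub> g) v = u \<longleftrightarrow> v = \<phi> g u" if "v \<in> V" for v
    using that assms orbit_sym_aux[of g u v] orbit_sym_aux[of "inv\<^bsub>G\<^esub> g" v u] by auto
  moreover have "\<phi> g u \<in> V" using assms element_image by blast
  ultimately show ?thesis by (auto simp: realised_action_def indicator_def fun_eq_iff)
qed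

definition pointwise_stabiliser ::
    "('g, 'm) monoid_scheme \<Rightarrow> 'v set \<Rightarrow> ('g \<Rightarrow> 'v \<Rightarrow> 'v) \<Rightarrow> ('v \<Rightarrow> real) set \<Rightarrow> 'g set"
  where "pointwise_stabiliser G V \<phi> \<gamma> = {g \<in> carrier G. \<forall>x\<in>\<gamma>. realised_action G V \<phi> g x = x}"

text \<open>
  A geodesic is carried along with its parametrisation \<open>c n\<close>, but inclusions and stabilisers only
  involve the image \<open>c n ` I n\<close>; its length is the length of the interval \<open>I n\<close>.
\<close>

definition stabilisation_property ::
    "('g, 'm) monoid_scheme \<Rightarrow> 'v set \<Rightarrow> 'v set set \<Rightarrow> ('g \<Rightarrow> 'v \<Rightarrow> 'v) \<Rightarrow> bool"
  where "stabilisation_property G V E \<phi> \<longleftrightarrow>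
    (\<forall>(I :: nat \<Rightarrow> real set) (c :: nat \<Rightarrow> real \<Rightarrow> 'v \<Rightarrow> real).
      (\<forall>n. is_geodesic V E (I n) (c n)) \<longrightarrow>
      (\<forall>n. c n ` I n \<subseteq> c (Suc n) ` I (Suc n)) \<or> (\<forall>n. c (Suc n) ` I (Suc n) \<subseteq> c n ` I n) \<longrightarrow>
      (\<lambda>n. emeasure lborel (I n)) \<longlonglongrightarrow> \<infinity> \<longrightarrow>
      (\<exists>N. \<forall>n\<ge>N. pointwise_stabiliser G V \<phi> (c n ` I n) =
                  pointwise_stabiliser G V \<phi> (c (Suc n) ` I (Suc n))))"

text \<open>
  The family of vertices is nonempty: the empty intersection would put \<open>G\<close> itself into the class.
\<close>

definition vertex_stabiliser_intersections ::
    "('g, 'm) monoid_scheme \<Rightarrow> 'v set \<Rightarrow> ('g \<Rightarrow> 'v \<Rightarrow> 'v) \<Rightarrow> 'g set set"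
  where "vertex_stabiliser_intersections G V \<phi> =
    {C. \<exists>S. S \<subseteq> V \<and> finite S \<and> S \<noteq> {} \<and> C = (\<Inter>v\<in>S. stabilizer G \<phi> v)}"

end

theory Submission
  imports Defs
begin

text \<open>
  Let \<open>g, h \<in> G\<close>. An element of \<open>G\<close> fixes a vertex or translates an axis. The alternative is
  decided by ping-pong on the vertices of the tree.

  \<^item> If \<open>g\<close> and \<open>h\<close> both fix a vertex, consider the subtrees of vertices fixed by some nontrivial
    power of \<open>g\<close>, respectively of \<open>h\<close>. If they meet, some powers \<open>g\<^sup>n, h\<^sup>n\<close> lie in a vertex
    stabiliser. Otherwise, all nontrivial powers move the ends of the bridge between the two
    subtrees, and suitable powers play ping-pong across it.
  \<^item> If \<open>h\<close> is a translation, take the two rays towards its ends from a vertex fixed by \<open>g\<close> (or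
    from any vertex if \<open>g\<close> is a translation too). If some \<open>g\<^sup>n\<close> fixes an end of \<open>h\<close>, both \<open>g\<^sup>n\<close> and
    \<open>h\<^sup>n\<close> lie in the stabiliser \<open>S\<close> of that end. Otherwise high powers play ping-pong with the
    half-trees cut off far out along the rays; when \<open>g\<close> fixes a vertex, the stabilisation property
    for increasing segments makes the distance uniform in the power of \<open>g\<close>.

  Finally, \<open>S\<close> is of the form \<open>\<langle>C, z\<rangle>\<close> with \<open>C\<close> normal: translation along the end is a homomorphism
  from \<open>S\<close> to the integers, and by the stabilisation property for decreasing rays and then for
  increasing segments its kernel is the pointwise stabiliser of a finite segment.
\<close>


section \<open>Ping-pong\<close>

lemma word_value_Cons:
  "word_value K g (x # w) = (if snd x then g (fst x) else inv\<^bsub>K\<^esub> (g (fst x))) \<otimes>\<^bsub>K\<^esub> word_value K g w"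
  by (simp add: word_value_def)

lemma word_value_append:
  assumes "group K" "\<forall>i\<in>X. g i \<in> carrier K" "set u \<subseteq> X \<times> UNIV" "set v \<subseteq> X \<times> UNIV"
  shows "word_value K g (u @ v) = word_value K g u \<otimes>\<^bsub>K\<^esub> word_value K g v"
proof -
  interpret group K by fact
  note c = word_value_closed[OF assms(1,2)]
  show ?thesis using assms(3)
  proof (induction u)
    case Nil
    then show ?case using c[OF assms(4)] by (simp add: word_value_def)
  next
    case (Cons x u)
    then have "g (fst x) \<in> carrier K" using assms(2) by auto
    then show ?case using Cons c[of u] c[OF assms(4)] by (simp add: word_value_Cons m_assoc)
  qed
qed

context group_action
begin

lemma is_group: "group G"
  using group_hom group_hom.axioms(1) by auto

lemma action_closed: "g \<in> carrier G \<Longrightarrow> v \<in> E \<Longrightarrow> \<phi> g v \<in> E"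
  using element_image by blast

lemma action_one: "v \<in> E \<Longrightarrow> \<phi> \<one> v = v"
  using id_eq_one by (metis restrict_apply')

lemma action_int_pow_add:
  fixes i j :: int
  shows "g \<in> carrier G \<Longrightarrow> v \<in> E \<Longrightarrow> \<phi> (g [^] (i + j)) v = \<phi> (g [^] i) (\<phi> (g [^] j) v)"
  using is_group by (simp add: composition_rule group.int_pow_mult group.int_pow_closed)

text \<open>The word acts from its last letter on, and the conclusion is an invariant describing the
  syllable in progress. Its exponent never cancels, since equal neighbouring generators of a reduced
  word have equal signs; a change of generator means that the finished syllable has moved the point
  into the other set. Ending in the first generator matches the start in \<open>Y\<close>.\<close>

lemma ping_pong_word:
  fixes a b :: 'a
  defines "gen \<equiv> \<lambda>i::nat. if i = 1 then a else b"
  assumes ab: "a \<in> carrier G" "b \<in> carrier G"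
    and XY: "X \<subseteq> E" "Y \<subseteq> E"
    and A: "\<And>k::int. k \<noteq> 0 \<Longrightarrow> \<phi> (a [^] k) ` Y \<subseteq> X"
    and B: "\<And>k::int. k \<noteq> 0 \<Longrightarrow> \<phi> (b [^] k) ` X \<subseteq> Y"
    and w: "set w \<subseteq> {1..2} \<times> UNIV" "reduced_word w" "w \<noteq> []" "fst (last w) = 1"
    and y0: "y0 \<in> Y"
  shows "\<exists>k > 0. \<exists>y \<in> (if fst (hd w) = 1 then Y else X).
    \<phi> (word_value G gen w) y0 = \<phi> (gen (fst (hd w)) [^] ((if snd (hd w) then 1 else - 1) * k :: int)) y"
  using w
proof (induction w)
  case (Cons x w)
  interpret group G by (rule is_group)
  define e :: int where "e = (if snd x then 1 else - 1)"
  have e0: "e \<noteq> 0" by (simp add: e_def)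
  have gen: "gen i \<in> carrier G" for i using ab by (simp add: gen_def)
  have letter: "(if snd x then gen (fst x) else inv (gen (fst x))) = gen (fst x) [^] e"
    using gen by (simp add: e_def int_pow_neg)
  have wv: "word_value G gen v \<in> carrier G" if "set v \<subseteq> {1..2} \<times> UNIV" for v
    using word_value_closed[OF is_group _ that, of gen] gen by simp
  have y0E: "y0 \<in> E" using y0 XY by blast
  have step: "\<phi> (word_value G gen (x # w)) y0 = \<phi> (gen (fst x) [^] e) (\<phi> (word_value G gen w) y0)"
    using wv[of w] Cons.prems(1) gen y0E by (simp add: word_value_Cons letter composition_rule)
  have gens: "fst x = 1 \<or> fst x = 2" using Cons.prems(1) by (cases x) auto
  show ?case
  proof (cases "w = []")
    case True
    then have "\<phi> (word_value G gen (x # w)) y0 = \<phi> (gen (fst x) [^] (e * 1)) y0"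
      using step y0E by (simp add: word_value_def action_one)
    then show ?thesis using True Cons.prems(4) y0
      by (intro exI[of _ 1]) (auto simp: e_def)
  next
    case False
    define f :: int where "f = (if snd (hd w) then 1 else - 1)"
    have f0: "f \<noteq> 0" by (simp add: f_def)
    have red: "reduced_word w" "hd w \<noteq> letter_inv x"
      using Cons.prems(2) False by (auto simp: reduced_word_def successively_Cons)
    obtain k y where k: "k > 0" "y \<in> (if fst (hd w) = 1 then Y else X)"
      and eq: "\<phi> (word_value G gen w) y0 = \<phi> (gen (fst (hd w)) [^] (f * k)) y"
      using Cons.IH[OF _ red(1) False] Cons.prems False unfolding f_def by auto
    have yE: "y \<in> E" using k XY by (auto split: if_splits)
    have hgens: "fst (hd w) = 1 \<or> fst (hd w) = 2"
      using Cons.prems(1) hd_in_set[OF False] by (cases "hd w") auto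
    show ?thesis
    proof (cases "fst (hd w) = fst x")
      case True
      then have "f = e" using red(2) by (auto simp: letter_inv_def e_def f_def prod_eq_iff)
      then have "\<phi> (word_value G gen (x # w)) y0 = \<phi> (gen (fst x) [^] (e * (k + 1))) y"
        using step eq True yE gen action_int_pow_add[of "gen (fst x)" y e "e * k"]
        by (simp add: distrib_left add.commute)
      then show ?thesis using k True unfolding e_def by (intro exI[of _ "k + 1"]) auto
    next
      case neq: False
      define z where "z = \<phi> (word_value G gen w) y0"
      have "f * k \<noteq> 0" using f0 k by simp
      then have "z \<in> (if fst x = 1 then Y else X)"
        using A[of "f * k"] B[of "f * k"] k(2) eq neq gens hgens
        by (auto simp: z_def gen_def split: if_splits)
      then show ?thesis using step unfolding e_def z_def by (intro exI[of _ 1]) auto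
    qed
  qed
qed simp

text \<open>A word that begins and ends with \<open>a\<close> or its inverse sends a point of
  \<open>Y\<close> into \<open>X\<close>, so its value is not neutral. Every other word is brought
  into this form by conjugation with \<open>a\<close> or its inverse.\<close>

lemma ping_pong_reduced_word_nontrivial:
  fixes a b :: 'a
  defines "gen \<equiv> \<lambda>i::nat. if i = 1 then a else b"
  assumes ab: "a \<in> carrier G" "b \<in> carrier G"
    and XY: "X \<subseteq> E" "Y \<subseteq> E" "X \<inter> Y = {}" "Y \<noteq> {}"
    and A: "\<And>k::int. k \<noteq> 0 \<Longrightarrow> \<phi> (a [^] k) ` Y \<subseteq> X"
    and B: "\<And>k::int. k \<noteq> 0 \<Longrightarrow> \<phi> (b [^] k) ` X \<subseteq> Y"
    and w: "set w \<subseteq> {1..2} \<times> UNIV" "reduced_word w" "w \<noteq> []"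
  shows "word_value G gen w \<noteq> \<one>"
proof
  assume one: "word_value G gen w = \<one>"
  interpret group G by (rule is_group)
  have gen: "\<forall>i\<in>{1..2}. gen i \<in> carrier G" using ab by (simp add: gen_def)
  obtain y0 where y0: "y0 \<in> Y" using XY(4) by blast
  have *: False
    if v: "set v \<subseteq> {1..2} \<times> UNIV" "reduced_word v" "v \<noteq> []" "fst (hd v) = 1" "fst (last v) = 1"
      and v1: "word_value G gen v = \<one>" for v
  proof -
    obtain k y where k: "k > 0" "y \<in> Y"
      "\<phi> (word_value G gen v) y0 = \<phi> (a [^] ((if snd (hd v) then 1 else - 1) * k :: int)) y"
      using ping_pong_word[OF ab XY(1,2) A B v(1-3,5) y0] v(4) unfolding gen_def by auto
    have "(if snd (hd v) then 1 else - 1) * k \<noteq> 0" using k(1) by auto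
    then have "\<phi> (word_value G gen v) y0 \<in> X" using A k(2,3) by blast
    moreover have "\<phi> (word_value G gen v) y0 = y0" using y0 XY(2) by (simp add: v1 action_one subset_iff)
    ultimately show False using y0 XY(3) by auto
  qed
  show False
  proof (cases "fst (hd w) = 1 \<and> fst (last w) = 1")
    case True
    then show ?thesis using *[of w] w one by blast
  next
    case False
    \<comment> \<open>If \<open>w\<close> starts with the first generator, its first letter is
      repeated; otherwise the sign is opposite to that of the last letter. In both cases neither
      junction of the conjugated word cancels.\<close>
    define x where "x = (1::nat, if fst (hd w) = 1 then snd (hd w) else \<not> snd (last w))"
    have x: "hd w \<noteq> letter_inv x" "last w \<noteq> x"
      using False by (auto simp: x_def letter_inv_def prod_eq_iff)
    have inv_neq: "letter_inv x \<noteq> letter_inv (last w)" using x(2) letter_inv_inv by metis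
    let ?v = "x # w @ [letter_inv x]"
    have "set ?v \<subseteq> {1..2} \<times> UNIV" using w(1) by (auto simp: x_def letter_inv_def)
    moreover have "reduced_word ?v"
      using w(2,3) x(1) inv_neq
      unfolding reduced_word_def by (auto simp: successively_Cons successively_append_iff)
    moreover have "word_value G gen ?v = \<one>"
    proof -
      have "word_value G gen ?v
        = word_value G gen [x] \<otimes> (word_value G gen w \<otimes> word_value G gen [letter_inv x])"
        using word_value_append[OF is_group gen, of "[x]" "w @ [letter_inv x]"]
          word_value_append[OF is_group gen w(1), of "[letter_inv x]"] w(1)
        by (auto simp: x_def letter_inv_def)
      also have "\<dots> = word_value G gen [x] \<otimes> word_value G gen [letter_inv x]"
        using word_value_closed[OF is_group gen, of "[letter_inv x]"]
        by (simp add: one x_def letter_inv_def)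
      also have "\<dots> = \<one>" using ab by (simp add: word_value_def x_def letter_inv_def gen_def)
      finally show ?thesis .
    qed
    ultimately show ?thesis using *[of ?v] by (simp add: x_def letter_inv_def)
  qed
qed

text \<open>Evaluation at \<open>a\<close> and \<open>b\<close> has trivial kernel by the preceding
  lemma, and its image, a subgroup containing both elements, is the subgroup they generate.\<close>

theorem ping_pong_free:
  fixes a b :: 'a
  assumes ab: "a \<in> carrier G" "b \<in> carrier G"
    and XY: "X \<subseteq> E" "Y \<subseteq> E" "X \<inter> Y = {}" "Y \<noteq> {}"
    and A: "\<And>k::int. k \<noteq> 0 \<Longrightarrow> \<phi> (a [^] k) ` Y \<subseteq> X"
    and B: "\<And>k::int. k \<noteq> 0 \<Longrightarrow> \<phi> (b [^] k) ` X \<subseteq> Y"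
  shows "subgroup_generated G {a, b} \<cong> free_group_rank 2"
proof -
  interpret group G by (rule is_group)
  define gen where "gen = (\<lambda>i::nat. if i = 1 then a else b)"
  let ?F = "free_group_rank 2" and ?K = "subgroup_generated G {a, b}" and ?f = "word_value G gen"
  have gen: "\<forall>i\<in>{1..2}. gen i \<in> carrier G" using ab by (simp add: gen_def)
  interpret F: group ?F by (rule group_free_group)
  have hom: "?f \<in> hom ?F G" by (rule word_value_hom[OF is_group gen])
  interpret f: group_hom ?F G ?f using hom by unfold_locales
  have inj: "inj_on ?f (carrier ?F)"
    unfolding f.inj_on_one_iff
  proof (intro allI impI)
    fix w assume w: "w \<in> carrier ?F" and "?f w = \<one>"
    then have "w = []"
      using ping_pong_reduced_word_nontrivial[OF ab XY A B, of w]
      unfolding gen_def by (auto simp: free_group_def)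
    then show "w = \<one>\<^bsub>?F\<^esub>" by (simp add: free_group_def)
  qed
  have K: "carrier ?K = generate G {a, b}"
    using ab by (simp add: carrier_subgroup_generated)
  have sub: "subgroup (generate G {a, b}) G" using ab by (intro generate_is_subgroup) auto
  have "?f ` carrier ?F = generate G {a, b}"
  proof
    show "?f ` carrier ?F \<subseteq> generate G {a, b}"
    proof clarify
      fix w assume "w \<in> carrier ?F"
      then have "set w \<subseteq> {1..2} \<times> UNIV" by (simp add: free_group_def)
      then show "?f w \<in> generate G {a, b}"
      proof (induction w)
        case Nil
        then show ?case by (simp add: word_value_def generate.one)
      next
        case (Cons x w)
        have "gen (fst x) \<in> {a, b}" by (simp add: gen_def)
        then have "(if snd x then gen (fst x) else inv (gen (fst x))) \<in> generate G {a, b}"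
          by (auto intro: generate.incl generate.inv)
        then show ?case using Cons by (simp add: word_value_Cons generate.eng)
      qed
    qed
    have "[(i, True)] \<in> carrier ?F" if "i \<in> {1..2}" for i
      using that by (auto simp: free_group_def reduced_word_def)
    moreover have "?f [(1, True)] = a" "?f [(2, True)] = b"
      using ab by (auto simp: word_value_def gen_def)
    ultimately have "{a, b} \<subseteq> ?f ` carrier ?F" by (force intro: rev_image_eqI)
    then show "generate G {a, b} \<subseteq> ?f ` carrier ?F"
      by (rule generate_subgroup_incl[OF _ f.img_is_subgroup])
  qed
  then have "?f \<in> iso ?F ?K"
    using hom inj K by (auto simp: iso_def hom_def bij_betw_def)
  then have "?F \<cong> ?K" by (auto simp: is_iso_def)
  then show ?thesis by (rule F.iso_sym)
qed

end


section \<open>The metric of a simplicial tree\<close>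

text \<open>Loops are cut while the path grows backwards: if the new start already occurs, only the
  part from that occurrence on is kept. Circuits are distinct lists, hence this form.\<close>

lemma rtrancl_distinct_path:
  assumes "(a, b) \<in> S\<^sup>*"
  shows "\<exists>xs. xs \<noteq> [] \<and> hd xs = a \<and> last xs = b \<and> distinct xs \<and> successively (\<lambda>x y. (x, y) \<in> S) xs"
  using assms
proof (induction rule: converse_rtrancl_induct)
  case base
  show ?case by (intro exI[of _ "[b]"]) simp
next
  case (step x y)
  then obtain xs where xs: "xs \<noteq> []" "hd xs = y" "last xs = b" "distinct xs"
    "successively (\<lambda>x y. (x, y) \<in> S) xs" by blast
  show ?case
  proof (cases "x \<in> set xs")
    case True
    then obtain ys zs where "xs = ys @ x # zs" by (meson split_list)
    then show ?thesis using xs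
      by (intro exI[of _ "x # zs"]) (auto simp: successively_append_iff)
  next
    case False
    then show ?thesis using xs step(1)
      by (intro exI[of _ "x # xs"]) (auto simp: successively_Cons)
  qed
qed

context simplicial_tree
begin

section \<open>Walks, graph distance and uniqueness of paths\<close>

definition adj :: "('v \<times> 'v) set"
  where "adj = {(x, y). {x, y} \<in> E}"

text \<open>Integer-valued, so that differences of distances are not truncated. The minimum is
  meaningful for vertices, which some walk always joins.\<close>

definition gdist :: "'v \<Rightarrow> 'v \<Rightarrow> int"
  where "gdist u v = int (LEAST n. (u, v) \<in> adj ^^ n)"

lemma adj_commute: "(x, y) \<in> adj \<longleftrightarrow> (y, x) \<in> adj"
  by (simp add: adj_def insert_commute)

lemma adj_in: "(x, y) \<in> adj \<Longrightarrow> x \<in> V \<and> y \<in> V \<and> x \<noteq> y"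
  using edges[of "{x, y}"] by (auto simp: adj_def)

lemma relpow_adj_commute: "(x, y) \<in> adj ^^ n \<Longrightarrow> (y, x) \<in> adj ^^ n"
proof (induction n arbitrary: y)
  case (Suc n)
  then obtain z where "(x, z) \<in> adj ^^ n" "(z, y) \<in> adj" by auto
  then show ?case using Suc.IH adj_commute relpow_Suc_I2 by metis
qed simp

lemma walk_exists:
  assumes "u \<in> V" "v \<in> V"
  shows "\<exists>n. (u, v) \<in> adj ^^ n"
proof -
  obtain xs where "xs \<noteq> []" "hd xs = u" "last xs = v"
      "successively (\<lambda>x y. {x, y} \<in> E) xs"
    using connected[OF assms] by blast
  then have "(u, v) \<in> adj\<^sup>*"
  proof (induction xs arbitrary: u)
    case (Cons x xs)
    then show ?case
      by (cases xs) (auto simp: adj_def intro: converse_rtrancl_into_rtrancl)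
  qed simp
  then show ?thesis using rtrancl_imp_relpow by metis
qed

lemma gdist_walk:
  assumes "u \<in> V" "v \<in> V"
  shows "(u, v) \<in> adj ^^ nat (gdist u v)"
  using LeastI_ex[OF walk_exists[OF assms]] by (simp add: gdist_def)

lemma gdist_le: "(u, v) \<in> adj ^^ n \<Longrightarrow> gdist u v \<le> int n"
  by (simp add: gdist_def Least_le)

lemma gdist_nonneg [simp]: "0 \<le> gdist u v"
  by (simp add: gdist_def)

lemma gdist_refl [simp]: "gdist u u = 0"
  using gdist_le[of u u 0] gdist_nonneg[of u u] by simp

lemma gdist_eq_0: "u \<in> V \<Longrightarrow> v \<in> V \<Longrightarrow> gdist u v = 0 \<longleftrightarrow> u = v"
  using gdist_walk[of u v] by auto

lemma gdist_commute: "gdist u v = gdist v u"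
proof -
  have "(u, v) \<in> adj ^^ n \<longleftrightarrow> (v, u) \<in> adj ^^ n" for n using relpow_adj_commute by blast
  then show ?thesis by (simp add: gdist_def)
qed

lemma gdist_triangle:
  assumes "u \<in> V" "v \<in> V" "t \<in> V"
  shows "gdist u t \<le> gdist u v + gdist v t"
proof -
  have "(u, t) \<in> adj ^^ (nat (gdist u v) + nat (gdist v t))"
    using gdist_walk[OF assms(1,2)] gdist_walk[OF assms(2,3)] by (auto simp: relpow_add)
  from gdist_le[OF this] show ?thesis by simp
qed

lemma gdist_adj: "(u, v) \<in> adj \<Longrightarrow> gdist u v = 1"
proof -
  assume a: "(u, v) \<in> adj"
  then have "gdist u v \<le> 1" "gdist u v \<noteq> 0"
    using gdist_le[of u v 1] adj_in[OF a] gdist_eq_0[of u v] by auto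
  then show ?thesis using gdist_nonneg[of u v] by linarith
qed

lemma gdist_eq_1: "u \<in> V \<Longrightarrow> v \<in> V \<Longrightarrow> gdist u v = 1 \<longleftrightarrow> (u, v) \<in> adj"
  using gdist_walk[of u v] gdist_adj by auto

text \<open>A shortest walk is cut after \<open>k\<close> steps; by the triangle inequality both
  pieces are again shortest.\<close>

lemma geodesic_point:
  assumes "u \<in> V" "v \<in> V" "0 \<le> k" "k \<le> gdist u v"
  shows "\<exists>m\<in>V. gdist u m = k \<and> gdist m v = gdist u v - k"
proof -
  have "(u, v) \<in> adj ^^ (nat k + nat (gdist u v - k))"
    using gdist_walk[OF assms(1,2)] assms(3,4) by (simp flip: nat_add_distrib)
  then obtain m where m: "(u, m) \<in> adj ^^ nat k" "(m, v) \<in> adj ^^ nat (gdist u v - k)"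
    unfolding relpow_add by blast
  have "m \<in> V"
    using m(1) assms(1) adj_in by (cases "nat k") auto
  then show ?thesis
    using gdist_le[OF m(1)] gdist_le[OF m(2)] gdist_triangle[OF assms(1) _ assms(2), of m] assms(3,4)
    by (intro bexI[of _ m]) auto
qed

lemma step_towards:
  assumes "u \<in> V" "v \<in> V" "u \<noteq> v"
  obtains w where "w \<in> V" "(u, w) \<in> adj" "gdist u w = 1" "gdist w v = gdist u v - 1"
proof -
  have "1 \<le> gdist u v" using gdist_eq_0[OF assms(1,2)] assms(3) gdist_nonneg[of u v] by linarith
  then obtain w where "w \<in> V" "gdist u w = 1" "gdist w v = gdist u v - 1"
    using geodesic_point[of u v 1] assms by auto
  then show thesis using that gdist_eq_1 assms(1) by blast
qed

text \<open>A path from \<open>a\<close> to \<open>b\<close> that avoids the edge would close up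
  with it to a circuit. Acyclicity enters all later arguments through this lemma alone.\<close>

lemma edge_is_bridge:
  assumes "(a, b) \<in> adj"
  shows "(a, b) \<notin> (adj - {(a, b), (b, a)})\<^sup>*"
proof
  assume "(a, b) \<in> (adj - {(a, b), (b, a)})\<^sup>*"
  then obtain xs where xs: "xs \<noteq> []" "hd xs = a" "last xs = b" "distinct xs"
    "successively (\<lambda>x y. (x, y) \<in> adj - {(a, b), (b, a)}) xs"
    using rtrancl_distinct_path by metis
  have "a \<noteq> b" using assms adj_in by blast
  have "length xs \<noteq> 1" using xs(1-3) \<open>a \<noteq> b\<close> by (auto simp: length_Suc_conv)
  moreover have "length xs \<noteq> 2"
  proof
    assume "length xs = 2"
    then obtain x y where "xs = [x, y]" by (auto simp: length_Suc_conv numeral_2_eq_2)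
    then show False using xs by simp
  qed
  ultimately have "length xs \<ge> 3" using xs(1) by (cases "length xs") auto
  moreover have "successively (\<lambda>u v. {u, v} \<in> E) xs"
    by (rule successively_mono[OF xs(5)]) (auto simp: adj_def)
  moreover have "{last xs, hd xs} \<in> E"
    using assms xs by (simp add: adj_def insert_commute)
  ultimately show False using no_circuit xs(4) by (auto simp: is_circuit_def)
qed

text \<open>Each step of a shortest walk from \<open>u\<close> comes strictly closer to
  \<open>p\<close>, so the walk never meets \<open>v\<close>, which is at least as far away as
  \<open>u\<close>.\<close>

lemma geodesic_avoids:
  assumes "p \<in> V" "u \<in> V" "v \<in> V" "u \<noteq> v" "gdist p u \<le> gdist p v"
  shows "(u, p) \<in> {(x, y) \<in> adj. x \<noteq> v \<and> y \<noteq> v}\<^sup>*"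
  using assms(2,4,5)
proof (induction "nat (gdist p u)" arbitrary: u)
  case 0
  then have "u = p" using gdist_eq_0[of p u] gdist_nonneg[of p u] assms(1) by (auto simp: le_less)
  then show ?case by simp
next
  case (Suc n)
  have "u \<noteq> p" using Suc.hyps(2) by auto
  then obtain m where m: "m \<in> V" "(u, m) \<in> adj" "gdist m p = gdist u p - 1"
    using step_towards Suc.prems assms(1) by metis
  have lt: "gdist p m < gdist p v" using m Suc.prems by (simp add: gdist_commute)
  then have "m \<noteq> v" by auto
  then have "(u, m) \<in> {(x, y) \<in> adj. x \<noteq> v \<and> y \<noteq> v}" using Suc.prems m by simp
  moreover have "(m, p) \<in> {(x, y) \<in> adj. x \<noteq> v \<and> y \<noteq> v}\<^sup>*"
    by (rule Suc.hyps(1)) (use m Suc lt \<open>m \<noteq> v\<close> in \<open>auto simp: gdist_commute\<close>)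
  ultimately show ?case by (rule converse_rtrancl_into_rtrancl)
qed

text \<open>If \<open>x\<close> and \<open>y\<close> differed, shortest walks from both to
  \<open>p\<close> would avoid \<open>v\<close>. Together with the edge from \<open>v\<close> to
  \<open>y\<close> they would lead from \<open>v\<close> to \<open>x\<close> around a
  bridge.\<close>

lemma unique_closer_neighbour:
  assumes "p \<in> V" "(v, x) \<in> adj" "(v, y) \<in> adj" "gdist p x \<le> gdist p v" "gdist p y \<le> gdist p v"
  shows "x = y"
proof (rule ccontr)
  assume "x \<noteq> y"
  let ?S = "adj - {(v, x), (x, v)}"
  note xy = adj_in[OF assms(2)] adj_in[OF assms(3)]
  have sub: "{(x, y) \<in> adj. x \<noteq> v \<and> y \<noteq> v}\<^sup>* \<subseteq> ?S\<^sup>*" by (rule rtrancl_mono) auto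
  have 1: "(x, p) \<in> ?S\<^sup>*" and 2: "(y, p) \<in> ?S\<^sup>*"
    using geodesic_avoids[of p x v] geodesic_avoids[of p y v] xy assms sub by auto
  have "sym ?S" using adj_commute by (auto simp: sym_def)
  then have "(p, x) \<in> ?S\<^sup>*" using 1 by (meson sym_rtrancl symD)
  moreover have "(v, y) \<in> ?S" using assms(3) \<open>x \<noteq> y\<close> xy by auto
  ultimately have "(v, x) \<in> ?S\<^sup>*" using 2 by (meson converse_rtrancl_into_rtrancl rtrancl_trans)
  then show False using edge_is_bridge[OF assms(2)] by simp
qed

text \<open>Trees are bipartite. At equal distance, \<open>x\<close> would have to coincide with the
  next vertex on the way from \<open>y\<close> to \<open>p\<close>, which is strictly
  closer.\<close>

lemma gdist_adj_neq:
  assumes "p \<in> V" "(x, y) \<in> adj"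
  shows "gdist p x \<noteq> gdist p y"
proof
  assume eq: "gdist p x = gdist p y"
  note xy = adj_in[OF assms(2)]
  have "y \<noteq> p" using eq xy gdist_eq_0 assms(1) gdist_refl by metis
  then obtain w where w: "w \<in> V" "(y, w) \<in> adj" "gdist w p = gdist y p - 1"
    using step_towards xy assms(1) by metis
  have "w = x"
    by (rule unique_closer_neighbour[OF assms(1), of y])
      (use w eq assms(2) adj_commute in \<open>auto simp: gdist_commute\<close>)
  then show False using w eq by (simp add: gdist_commute)
qed

section \<open>Betweenness, medians and Gromov products\<close>

definition btw :: "'v \<Rightarrow> 'v \<Rightarrow> 'v \<Rightarrow> bool"
  where "btw u m v \<longleftrightarrow> gdist u m + gdist m v = gdist u v"

lemma btw_commute: "btw u m v \<longleftrightarrow> btw v m u"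
  by (auto simp: btw_def gdist_commute)

text \<open>Induction on the distance from \<open>x\<close> to \<open>y\<close>: the last vertex
  \<open>y\<close> is replaced by its neighbour towards \<open>x\<close>, and the median found there
  is kept or moved by one edge.\<close>

lemma median:
  assumes "p \<in> V" "x \<in> V" "y \<in> V"
  shows "\<exists>m\<in>V. btw p m x \<and> btw p m y \<and> btw x m y"
  using assms(3)
proof (induction "nat (gdist x y)" arbitrary: y)
  case 0
  then have "x = y" using gdist_eq_0[of x y] gdist_nonneg[of x y] assms(2) by (auto simp: le_less)
  then show ?case using assms by (intro bexI[of _ x]) (auto simp: btw_def)
next
  case (Suc n)
  have "y \<noteq> x" using Suc.hyps(2) by auto
  then obtain y' where y': "y' \<in> V" "gdist y y' = 1" "gdist y' x = gdist y x - 1"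
    using step_towards Suc.prems assms(2) by metis
  then have adj: "(y, y') \<in> adj" "(y', y) \<in> adj"
    using gdist_eq_1 adj_commute Suc.prems by auto
  obtain m where m: "m \<in> V" "btw p m x" "btw p m y'" "btw x m y'"
    using Suc.hyps(1)[of y'] Suc.hyps(2) y' gdist_commute[of y x] gdist_commute[of y' x] by fastforce
  have my: "gdist m y \<le> gdist m y' + 1"
    using gdist_triangle[OF m(1) y'(1) Suc.prems] y'(2) by (simp add: gdist_commute)
  have "gdist p y \<noteq> gdist p y'" using gdist_adj_neq[OF assms(1) adj(1)] by simp
  moreover have "gdist p y \<le> gdist p y' + 1" "gdist p y' \<le> gdist p y + 1"
    using gdist_triangle[OF assms(1) y'(1) Suc.prems] gdist_triangle[OF assms(1) Suc.prems y'(1)] y'(2)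
    by (auto simp: gdist_commute)
  ultimately consider "gdist p y = gdist p y' + 1" | "gdist p y' = gdist p y + 1" by linarith
  then show ?case
  proof cases
    case 1
    then show ?thesis
      using m my y'(3) gdist_triangle[OF assms(1) m(1) Suc.prems] gdist_triangle[OF assms(2) m(1) Suc.prems]
      by (intro bexI[of _ m]) (auto simp: btw_def gdist_commute)
  next
    \<comment> \<open>Here \<open>y\<close> precedes \<open>y'\<close> on the way from
      \<open>p\<close>. If the old median is \<open>y'\<close>, the new one is \<open>y\<close>;
      otherwise the first step from \<open>y'\<close> towards \<open>m\<close> also leads towards
      \<open>p\<close>, so it is \<open>y\<close>, and \<open>m\<close> remains the median.\<close>
    case 2
    show ?thesis
    proof (cases "m = y'")
      case True
      then show ?thesis
        using m y' 2 Suc.prems by (intro bexI[of _ y]) (auto simp: btw_def gdist_commute)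
    next
      case False
      then obtain w where w: "w \<in> V" "(y', w) \<in> adj" "gdist y' w = 1" "gdist w m = gdist y' m - 1"
        using step_towards y' m by metis
      have "gdist p w \<le> gdist p y'"
        using gdist_triangle[OF assms(1) m(1) w(1)] w m(3) by (simp add: btw_def gdist_commute)
      then have "w = y"
        by (intro unique_closer_neighbour[OF assms(1), of y'])
          (use w y' adj 2 gdist_eq_1 in auto)
      then show ?thesis
        using gdist_triangle[OF assms(2) m(1) Suc.prems] w m(4) y'
        by (simp add: btw_def gdist_commute)
    qed
  qed
qed

text \<open>Both geodesics are retraced from \<open>y\<close>: their last edges lead closer to
  \<open>p\<close>, so they agree, and the distance to \<open>s\<close> drops by one.\<close>

lemma btw_unique:
  assumes "p \<in> V" "s \<in> V" "s' \<in> V" "y \<in> V" "btw p s y" "btw p s' y" "gdist p s = gdist p s'"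
  shows "s = s'"
  using assms(4-6)
proof (induction "nat (gdist s y)" arbitrary: y)
  case 0
  then have "gdist s y = 0" "gdist s' y = 0"
    using gdist_nonneg[of s y] assms(7) by (auto simp: le_less btw_def)
  then show ?case using gdist_eq_0 0 assms by metis
next
  case (Suc n)
  have eq: "gdist s' y = gdist s y" using Suc.prems assms(7) by (simp add: btw_def)
  then have "y \<noteq> s" "y \<noteq> s'" using Suc.hyps(2) by auto
  then obtain t t' where t: "t \<in> V" "(y, t) \<in> adj" "gdist y t = 1" "gdist t s = gdist y s - 1"
    and t': "t' \<in> V" "(y, t') \<in> adj" "gdist y t' = 1" "gdist t' s' = gdist y s' - 1"
    using step_towards Suc.prems assms(2,3) by metis
  have le: "gdist p t \<le> gdist p y - 1" "gdist p t' \<le> gdist p y - 1"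
    using gdist_triangle[OF assms(1,2) t(1)] gdist_triangle[OF assms(1,3) t'(1)] t t' Suc.prems
    by (auto simp: btw_def gdist_commute)
  have "t = t'"
    by (rule unique_closer_neighbour[OF assms(1), of y])
      (use t t' le in auto)
  moreover have "btw p s t" "btw p s' t'"
    using gdist_triangle[OF assms(1,2) t(1)] gdist_triangle[OF assms(1,3) t'(1)] t t' Suc.prems
      gdist_triangle[OF assms(1) t(1) Suc.prems(1)] gdist_triangle[OF assms(1) t'(1) Suc.prems(1)]
    by (auto simp: btw_def gdist_commute)
  ultimately show ?case using Suc.hyps(1)[of t] t Suc.hyps(2) by (auto simp: gdist_commute)
qed

text \<open>Twice the Gromov product of \<open>x\<close> and \<open>y\<close> based at \<open>p\<close>.\<close>

definition gprod :: "'v \<Rightarrow> 'v \<Rightarrow> 'v \<Rightarrow> int"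
  where "gprod p x y = gdist p x + gdist p y - gdist x y"

lemma gprod_commute: "gprod p x y = gprod p y x"
  by (simp add: gprod_def gdist_commute)

lemma btw_trans:
  assumes "p \<in> V" "s \<in> V" "m \<in> V" "y \<in> V" "btw p s m" "btw p m y"
  shows "btw p s y"
  using assms gdist_triangle[of p s y] gdist_triangle[of s m y] by (auto simp: btw_def)

text \<open>The vertex of the geodesic from \<open>p\<close> to \<open>m\<close> at the distance of
  \<open>s\<close> also lies on the way to \<open>y\<close>, so uniqueness identifies it with
  \<open>s\<close>.\<close>

lemma btw_le_btw:
  assumes "p \<in> V" "s \<in> V" "m \<in> V" "y \<in> V" "btw p s y" "btw p m y" "gdist p s \<le> gdist p m"
  shows "btw p s m"
proof -
  obtain s' where s': "s' \<in> V" "gdist p s' = gdist p s" "gdist s' m = gdist p m - gdist p s"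
    using geodesic_point[of p m "gdist p s"] assms by auto
  then have b: "btw p s' m" by (simp add: btw_def)
  then have "btw p s' y" using btw_trans s' assms by blast
  then have "s = s'" using btw_unique[OF assms(1,2) s'(1) assms(4,5)] s'(2) by simp
  then show ?thesis using b by simp
qed

lemma btw_median_gprod:
  assumes "btw p m x" "btw p m y" "btw x m y"
  shows "gprod p x y = 2 * gdist p m"
  using assms by (simp add: btw_def gprod_def gdist_commute)

lemma gprod_ge:
  assumes "p \<in> V" "m \<in> V" "x \<in> V" "y \<in> V" "btw p m x" "btw p m y"
  shows "gprod p x y \<ge> 2 * gdist p m"
  using assms gdist_triangle[of x m y] by (simp add: btw_def gprod_def gdist_commute)

text \<open>This is 0-hyperbolicity. The medians \<open>m\<close> and \<open>k\<close> both lie on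
  the geodesic from \<open>p\<close> to \<open>y\<close>; the one nearer to \<open>p\<close>
  therefore lies on the way to \<open>x\<close> and to \<open>z\<close> as well.\<close>

lemma four_point:
  assumes "p \<in> V" "x \<in> V" "y \<in> V" "z \<in> V"
  shows "min (gprod p x y) (gprod p y z) \<le> gprod p x z"
proof -
  obtain m where m: "m \<in> V" "btw p m x" "btw p m y" "btw x m y" using median assms by blast
  obtain k where k: "k \<in> V" "btw p k y" "btw p k z" "btw y k z" using median assms by blast
  note g = btw_median_gprod[OF m(2-4)] btw_median_gprod[OF k(2-4)]
  show ?thesis
  proof (cases "gdist p m \<le> gdist p k")
    case True
    then have "btw p m k" using btw_le_btw[of p m k y] assms m k by blast
    then have "btw p m z" using btw_trans[of p m k z] assms m k by blast
    then show ?thesis using gprod_ge[of p m x z] g assms m by linarith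
  next
    case False
    then have "btw p k m" using btw_le_btw[of p k m y] assms m k by simp
    then have "btw p k x" using btw_trans[of p k m x] assms m k by blast
    then show ?thesis using gprod_ge[of p k x z] g assms k by linarith
  qed
qed

lemma btw_iff_gprod: "btw p s x \<longleftrightarrow> gprod p s x = 2 * gdist p s"
  by (auto simp: btw_def gprod_def)

lemma gprod_le:
  assumes "p \<in> V" "s \<in> V" "x \<in> V"
  shows "gprod p s x \<le> 2 * gdist p s"
  using gdist_triangle[of p s x] assms by (simp add: gprod_def)

lemma gprod_nonneg:
  assumes "p \<in> V" "x \<in> V" "y \<in> V"
  shows "0 \<le> gprod p x y"
  using gdist_triangle[of x p y] assms by (simp add: gprod_def gdist_commute)

text \<open>The geodesics from \<open>p\<close> to \<open>x\<close> and to \<open>y\<close> share an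
  initial segment of half the length \<open>gprod p x y\<close>. In the four-point inequality for
  \<open>s\<close>, \<open>x\<close>, \<open>y\<close> betweenness is the case where the product
  attains its maximum \<open>2 * gdist p s\<close>.\<close>

lemma btw_gprod_transfer:
  assumes "p \<in> V" "s \<in> V" "x \<in> V" "y \<in> V" "btw p s x" "2 * gdist p s \<le> gprod p x y"
  shows "btw p s y"
  using four_point[of p s x y] gprod_le[of p s y] assms by (auto simp: btw_iff_gprod)

lemma branches_coincide:
  assumes "p \<in> V" "s \<in> V" "s' \<in> V" "x \<in> V" "y \<in> V" "btw p s x" "btw p s' y"
    "gdist p s = gdist p s'" "2 * gdist p s \<le> gprod p x y"
  shows "s = s'"
  using btw_gprod_transfer[of p s x y] btw_unique[of p s s' y] assms by blast

section \<open>Rays of vertices and convergence to an end\<close>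

definition ray :: "(nat \<Rightarrow> 'v) \<Rightarrow> bool"
  where "ray x \<longleftrightarrow> (\<forall>i. x i \<in> V) \<and> (\<forall>i j. gdist (x i) (x j) = \<bar>int i - int j\<bar>)"

lemma ray_in: "ray x \<Longrightarrow> x i \<in> V"
  by (simp add: ray_def)

lemma ray_gdist: "ray x \<Longrightarrow> gdist (x i) (x j) = \<bar>int i - int j\<bar>"
  by (simp add: ray_def)

lemma ray_inj: "ray x \<Longrightarrow> x i = x j \<longleftrightarrow> i = j"
  using ray_gdist[of x i j] by auto

lemma ray_shift: "ray x \<Longrightarrow> ray (\<lambda>i. x (n + i))"
  by (auto simp: ray_def)

lemma ray_edge: "ray x \<Longrightarrow> {x i, x (Suc i)} \<in> E"
  using gdist_eq_1[of "x i" "x (Suc i)"] by (simp add: ray_def adj_def)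

lemma ray_btw_origin:
  assumes "ray u" "i \<le> j"
  shows "btw (u 0) (u i) (u j)"
  using assms by (simp add: btw_def ray_gdist)

lemma rays_agree_below:
  assumes "ray u" "ray t" "u 0 = t 0" "u K = t K" "i \<le> K"
  shows "u i = t i"
  using btw_unique[of "u 0" "u i" "t i" "u K"] ray_btw_origin[OF assms(1,5)] ray_btw_origin[OF assms(2,5)]
    ray_in[OF assms(1)] ray_in[OF assms(2)] ray_gdist[OF assms(1), of 0 i] ray_gdist[OF assms(2), of 0 i]
    assms(3,4) by simp

text \<open>Once the Gromov products exceed \<open>2 * K\<close>, the vertex at distance
  \<open>K\<close> on the geodesic from \<open>p\<close> to \<open>z n\<close> no longer depends on
  \<open>n\<close>. These limit vertices form the ray.\<close>

lemma sequence_ray: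
  fixes z :: "nat \<Rightarrow> 'v"
  assumes p: "p \<in> V" and z: "\<And>n. z n \<in> V"
    and cauchy: "\<And>K::nat. \<exists>N. \<forall>m\<ge>N. \<forall>n\<ge>N. 2 * int K \<le> gprod p (z m) (z n)"
  obtains u where "ray u" "u 0 = p" "\<And>K. \<exists>N. \<forall>n\<ge>N. btw p (u K) (z n)"
proof -
  obtain N where N: "\<And>K m n. N K \<le> m \<Longrightarrow> N K \<le> n \<Longrightarrow> 2 * int K \<le> gprod p (z m) (z n)"
    using cauchy by metis
  have "\<exists>s\<in>V. gdist p s = int K \<and> (\<forall>n\<ge>N K. btw p s (z n))" for K
  proof -
    \<comment> \<open>The product of a vertex with itself is twice its distance from
      \<open>p\<close>, so the bound for equal indices places \<open>z (N K)\<close> at distance at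
      least \<open>K\<close>.\<close>
    have "int K \<le> gdist p (z (N K))" using N[of K "N K" "N K", OF order_refl order_refl] by (simp add: gprod_def)
    then obtain s where s: "s \<in> V" "gdist p s = int K" "gdist s (z (N K)) = gdist p (z (N K)) - int K"
      using geodesic_point[OF p z, of "int K"] by auto
    have "btw p s (z (N K))" using s by (simp add: btw_def)
    then have "btw p s (z n)" if "n \<ge> N K" for n
      using btw_gprod_transfer[OF p s(1) z z] s(2) N[of K "N K" n] that by simp
    then show ?thesis using s by blast
  qed
  then obtain u where u: "\<And>K. u K \<in> V" "\<And>K. gdist p (u K) = int K" "\<And>K n. n \<ge> N K \<Longrightarrow> btw p (u K) (z n)"
    by metis
  have le: "gdist (u i) (u j) = int j - int i" if "i \<le> j" for i j
  proof -
    have "btw p (u i) (u j)"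
      by (rule btw_le_btw[OF p u(1) u(1) z[of "max (N i) (N j)"]]) (use u that in auto)
    then show ?thesis using u(2) by (simp add: btw_def)
  qed
  have "ray u"
    unfolding ray_def
  proof (intro conjI allI)
    fix i j show "gdist (u i) (u j) = \<bar>int i - int j\<bar>"
      using le[of i j] le[of j i] by (cases "i \<le> j") (auto simp: gdist_commute)
  qed (rule u(1))
  moreover have "u 0 = p" using gdist_eq_0[OF p u(1)[of 0]] u(2)[of 0] by simp
  ultimately show thesis using that u(3) by blast
qed

text \<open>Beyond distance \<open>gdist (u 0) (u' 0)\<close> from its origin, every vertex of
  \<open>u\<close> also lies on the geodesics from \<open>u' 0\<close> to late \<open>z n\<close>.
  Its distance from \<open>u' 0\<close> grows by one per index, so uniqueness puts it on
  \<open>u'\<close>.\<close>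

lemma rays_to_same_sequence_merge:
  fixes z :: "nat \<Rightarrow> 'v"
  assumes u: "ray u" "\<And>K. \<exists>N. \<forall>n\<ge>N. btw (u 0) (u K) (z n)"
    and u': "ray u'" "\<And>K. \<exists>N. \<forall>n\<ge>N. btw (u' 0) (u' K) (z n)"
    and z: "\<And>n. z n \<in> V"
  shows "\<exists>a b. \<forall>i. u' (a + i) = u (b + i)"
proof -
  let ?p = "u 0" and ?q = "u' 0"
  note V = ray_in[OF u(1)] ray_in[OF u'(1)]
  define D where "D = gdist ?p ?q"
  have on: "btw ?q (u i) (z n) \<and> gdist ?q (u i) = gdist ?q (z n) - gdist ?p (z n) + int i"
    if i: "int i \<ge> D" and n: "btw ?p (u i) (z n)" for i n
  proof -
    have pi: "gdist ?p (u i) = int i" using ray_gdist[OF u(1), of 0 i] by simp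
    have tri: "gdist (z n) ?q \<ge> gdist (z n) ?p - D"
      using gdist_triangle[of "z n" ?q ?p] V z by (simp add: D_def gdist_commute)
    have "2 * gdist (z n) (u i) \<le> gprod (z n) ?p ?q"
      using n pi i tri by (simp add: gprod_def btw_def D_def gdist_commute)
    moreover have "btw (z n) (u i) ?p" using n btw_commute by blast
    ultimately have "btw (z n) (u i) ?q"
      using btw_gprod_transfer[of "z n" "u i" ?p ?q] V z by blast
    then show ?thesis using n pi by (auto simp: btw_def gdist_commute)
  qed
  define b where "b = nat D"
  \<comment> \<open>The index at which \<open>u'\<close> meets \<open>u b\<close> is the distance of
    \<open>u b\<close> from the origin of \<open>u'\<close>.\<close>
  define a where "a = nat (gdist ?q (u b))"
  have "u' (a + i) = u (b + i)" for i
  proof -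
    obtain N1 where N1: "\<And>n. n \<ge> N1 \<Longrightarrow> btw ?p (u b) (z n)" using u(2)[of b] by blast
    obtain N2 where N2: "\<And>n. n \<ge> N2 \<Longrightarrow> btw ?p (u (b + i)) (z n)" using u(2)[of "b + i"] by blast
    obtain N3 where N3: "\<And>n. n \<ge> N3 \<Longrightarrow> btw ?q (u' (a + i)) (z n)" using u'(2)[of "a + i"] by blast
    define n where "n = max N1 (max N2 N3)"
    have n: "btw ?p (u b) (z n)" "btw ?p (u (b + i)) (z n)" "btw ?q (u' (a + i)) (z n)"
      using N1 N2 N3 by (auto simp: n_def)
    have bi: "int b \<ge> D" "int (b + i) \<ge> D" by (auto simp: b_def)
    have "gdist ?q (u (b + i)) = gdist ?q (u b) + int i"
      using on[OF bi(1) n(1)] on[OF bi(2) n(2)] by simp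
    also have "\<dots> = gdist ?q (u' (a + i))"
    proof -
      have "int a = gdist ?q (u b)" by (simp add: a_def)
      then show ?thesis using ray_gdist[OF u'(1), of 0 "a + i"] by simp
    qed
    finally show ?thesis
      using btw_unique[of ?q "u (b + i)" "u' (a + i)" "z n"] on[OF bi(2) n(2)] n(3) V z by auto
  qed
  then show ?thesis by blast
qed

end


section \<open>Rays in the geometric realisation\<close>

lemma real_between_nats:
  assumes "0 \<le> (t::real)"
  obtains i where "real i \<le> t" "t \<le> real i + 1"
  using assms that[of "nat \<lfloor>t\<rfloor>"] by (auto simp: of_nat_nat)

context simplicial_tree
begin

text \<open>Barycentric coordinates of the point at arc length \<open>t\<close>, meaningful for
  nonnegative \<open>t\<close>.\<close>

definition ray_point :: "(nat \<Rightarrow> 'v) \<Rightarrow> real \<Rightarrow> 'v \<Rightarrow> real"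
  where "ray_point x t v =
    (1 - frac t) * indicator {x (nat \<lfloor>t\<rfloor>)} v + frac t * indicator {x (Suc (nat \<lfloor>t\<rfloor>))} v"

text \<open>At the right end \<open>t = real i + 1\<close> the floor has already jumped to the next
  vertex, but the formula persists. One expression thus covers a whole closed edge.\<close>

lemma ray_point_eq:
  assumes "real i \<le> t" "t \<le> real i + 1"
  shows "ray_point x t v = (1 - (t - real i)) * indicator {x i} v + (t - real i) * indicator {x (Suc i)} v"
proof (cases "t = real i + 1")
  case True
  then have "t = real (Suc i)" by simp
  then have "nat \<lfloor>t\<rfloor> = Suc i" "frac t = 0" by (metis floor_of_nat nat_int, metis frac_eq_0_iff Ints_of_nat)
  then show ?thesis using True by (simp only: ray_point_def) simp
next
  case False
  then have "\<lfloor>t\<rfloor> = int i" using assms by (simp add: floor_eq_iff)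
  then show ?thesis by (simp add: ray_point_def frac_def)
qed

lemma ray_point_nat: "ray_point x (real i) = indicator {x i}"
  using ray_point_eq[of i "real i" x] by auto

lemma ray_point_in_cell:
  assumes "ray x" "real i \<le> t" "t \<le> real i + 1"
  shows "ray_point x t \<in> closed_cell {x i, x (Suc i)}"
  using ray_inj[OF assms(1), of i "Suc i"] assms(2,3)
  by (auto simp: closed_cell_def ray_point_eq[OF assms(2,3)])

lemma ray_point_in_realisation:
  assumes "ray x" "0 \<le> t"
  shows "ray_point x t \<in> realisation V E"
proof -
  obtain i where i: "real i \<le> t" "t \<le> real i + 1" using real_between_nats[OF assms(2)] .
  show ?thesis
    using ray_point_in_cell[OF assms(1) i] ray_edge[OF assms(1), of i]
    by (auto simp: realisation_def tree_cells_def)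
qed

lemma tree_dist_ray_point_edge:
  assumes "ray x" "real i \<le> s" "s \<le> real i + 1" "real i \<le> t" "t \<le> real i + 1"
  shows "tree_dist V E (ray_point x s) (ray_point x t) = \<bar>s - t\<bar>"
proof -
  have "x i \<noteq> x (Suc i)" using ray_inj[OF assms(1)] by simp
  then show ?thesis
    using tree_dist_edge[OF ray_edge[OF assms(1)] ray_point_in_cell[OF assms(1-3)]
        ray_point_in_cell[OF assms(1,4,5)]]
    by (simp add: ray_point_eq[OF assms(2,3)] ray_point_eq[OF assms(4,5)])
qed

lemma tree_dist_ray_point_le:
  assumes "ray x" "0 \<le> s" "s \<le> t"
  shows "tree_dist V E (ray_point x s) (ray_point x t) \<le> t - s"
proof -
  have "tree_dist V E (ray_point x s) (ray_point x t) \<le> t - s"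
    if "s \<le> t" "t \<le> real n + 1" for n t
    using that
  proof (induction n arbitrary: t)
    case 0
    then show ?case using tree_dist_ray_point_edge[OF assms(1), of 0 s t] assms(2) by simp
  next
    case (Suc n)
    consider "t \<le> real n + 1" | "real (Suc n) \<le> s" | "s < real (Suc n)" "real (Suc n) < t"
      by fastforce
    then show ?case
    proof cases
      case 1
      then show ?thesis using Suc by blast
    next
      case 2
      then show ?thesis using tree_dist_ray_point_edge[OF assms(1), of "Suc n" s t] Suc.prems by simp
    next
      case 3
      then have "tree_dist V E (ray_point x s) (ray_point x (real (Suc n))) \<le> real (Suc n) - s"
        by (intro Suc.IH) auto
      moreover have "tree_dist V E (ray_point x (real (Suc n))) (ray_point x t) = t - real (Suc n)"
        using tree_dist_ray_point_edge[OF assms(1), of "Suc n" "real (Suc n)" t] Suc.prems 3 by simp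
      ultimately show ?thesis
        using tree_dist_triangle[of "ray_point x s" "ray_point x (real (Suc n))" "ray_point x t"]
          ray_point_in_realisation[OF assms(1)] assms(2) Suc.prems
        by fastforce
    qed
  qed
  moreover obtain i where "t \<le> real i + 1" using real_between_nats[of t] assms by auto
  ultimately show ?thesis using assms(3) by blast
qed

text \<open>A 1-Lipschitz function whose increments bound distances in the realisation from below.\<close>

definition height :: "'v \<Rightarrow> ('v \<Rightarrow> real) \<Rightarrow> real"
  where "height p x = (\<Sum>u | x u \<noteq> 0. x u * real_of_int (gdist p u))"

lemma height_cell:
  assumes "\<sigma> \<in> tree_cells V E" "x \<in> closed_cell \<sigma>"
  shows "height p x = (\<Sum>u\<in>\<sigma>. x u * real_of_int (gdist p u))"
  unfolding height_def
  by (rule sum.mono_neutral_left) (use assms finite_cell in \<open>auto simp: closed_cell_def\<close>)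

text \<open>On an edge the height is affine, with slope the difference of the distances of the two
  ends from \<open>p\<close>, which is at most one in absolute value.\<close>

lemma height_cell_lipschitz:
  assumes "p \<in> V" "\<sigma> \<in> tree_cells V E" "x \<in> closed_cell \<sigma>" "y \<in> closed_cell \<sigma>"
  shows "\<bar>height p x - height p y\<bar> \<le> (\<Sum>v\<in>\<sigma>. \<bar>x v - y v\<bar>) / 2"
proof (cases "\<sigma> \<in> E")
  case True
  then obtain u v where uv: "\<sigma> = {u, v}" "u \<noteq> v"
    using edges by (metis card_2_iff)
  then have adj: "(u, v) \<in> adj" using True by (simp add: adj_def)
  note V = adj_in[OF adj]
  have "\<bar>gdist p u - gdist p v\<bar> \<le> 1"
    using gdist_triangle[of p u v] gdist_triangle[of p v u] V assms(1) gdist_adj[OF adj]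
    by (auto simp: gdist_commute)
  then have le: "\<bar>real_of_int (gdist p u) - real_of_int (gdist p v)\<bar> \<le> 1" by linarith
  have e: "x v - y v = - (x u - y u)" using assms(3,4) uv by (simp add: closed_cell_def)
  have "height p x - height p y
      = (x u - y u) * real_of_int (gdist p u) + (x v - y v) * real_of_int (gdist p v)"
    using uv by (simp add: height_cell[OF assms(2,3)] height_cell[OF assms(2,4)] algebra_simps)
  also have "\<dots> = (x u - y u) * (real_of_int (gdist p u) - real_of_int (gdist p v))"
    unfolding e by (simp add: algebra_simps)
  finally have "\<bar>height p x - height p y\<bar>
      = \<bar>x u - y u\<bar> * \<bar>real_of_int (gdist p u) - real_of_int (gdist p v)\<bar>" by (simp add: abs_mult)
  then have "\<bar>height p x - height p y\<bar> \<le> \<bar>x u - y u\<bar>"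
    using le by (simp add: mult_left_le)
  moreover have "\<bar>x v - y v\<bar> = \<bar>x u - y u\<bar>" using e by (metis abs_minus_cancel)
  ultimately show ?thesis using uv by simp
next
  case False
  then obtain v where "\<sigma> = {v}" using assms(2) by (auto simp: tree_cells_def)
  then show ?thesis
    using assms(3,4) by (simp add: height_cell[OF assms(2,3)] height_cell[OF assms(2,4)] closed_cell_def)
qed

lemma height_lipschitz:
  assumes "p \<in> V" "x \<in> realisation V E" "y \<in> realisation V E"
  shows "\<bar>height p x - height p y\<bar> \<le> tree_dist V E x y"
proof -
  have "\<bar>height p x - height p y\<bar> \<le> l" if "pl_path V E x l y" for l
    using that
  proof (induction rule: pl_path.induct)
    case (step \<sigma> x y l z)
    then show ?case using height_cell_lipschitz[OF assms(1) step(1-3)] by linarith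
  qed simp
  then show ?thesis
    unfolding tree_dist_def using pl_path_exists[OF assms(2,3)] by (intro cInf_greatest) auto
qed

lemma height_ray_point:
  assumes "ray x" "0 \<le> t"
  shows "height (x 0) (ray_point x t) = t"
proof -
  obtain i where i: "real i \<le> t" "t \<le> real i + 1" using real_between_nats[OF assms(2)] .
  have c: "{x i, x (Suc i)} \<in> tree_cells V E"
    using ray_edge[OF assms(1)] by (simp add: tree_cells_def)
  have "x i \<noteq> x (Suc i)" using ray_inj[OF assms(1)] by simp
  then show ?thesis
    by (simp add: height_cell[OF c ray_point_in_cell[OF assms(1) i]] ray_point_eq[OF i]
        ray_gdist[OF assms(1)] algebra_simps)
qed

text \<open>Concatenating edges bounds the distance from above. The 1-Lipschitz height based at
  \<open>x 0\<close> equals the parameter along the ray and bounds it from below.\<close>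

lemma ray_point_geodesic:
  assumes "ray x" "is_interval I" "closed I" "I \<noteq> {}" "I \<subseteq> {0..}"
  shows "is_geodesic V E I (ray_point x)"
proof -
  have real: "ray_point x t \<in> realisation V E" if "t \<in> I" for t
    using ray_point_in_realisation[OF assms(1)] that assms(5) by auto
  have le: "tree_dist V E (ray_point x s) (ray_point x t) \<le> \<bar>s - t\<bar>" if "s \<in> I" "t \<in> I" for s t
  proof (cases "s \<le> t")
    case True
    then show ?thesis using tree_dist_ray_point_le[OF assms(1), of s t] that assms(5) by auto
  next
    case False
    then show ?thesis
      using tree_dist_ray_point_le[OF assms(1), of t s] that assms(5) by (auto simp: tree_dist_sym)
  qed
  have ge: "\<bar>s - t\<bar> \<le> tree_dist V E (ray_point x s) (ray_point x t)" if "s \<in> I" "t \<in> I" for s t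
    using height_lipschitz[OF ray_in[OF assms(1)] real[OF that(1)] real[OF that(2)], of 0]
      height_ray_point[OF assms(1)] that assms(5)
    by (simp add: subset_iff)
  show ?thesis
    using assms(2-4) real le ge
    by (auto simp: is_geodesic_def isometric_embedding_def intro: antisym)
qed

end


section \<open>Actions on trees\<close>

locale tree_action = simplicial_tree V E + group_action G V \<phi>
  for G (structure) and V :: "'v set" and E :: "'v set set" and \<phi> +
  assumes preserves_edges:
      "\<lbrakk>g \<in> carrier G; u \<in> V; v \<in> V\<rbrakk> \<Longrightarrow> {\<phi> g u, \<phi> g v} \<in> E \<longleftrightarrow> {u, v} \<in> E"
    and no_inversions: "\<lbrakk>g \<in> carrier G; {u, v} \<in> E; \<phi> g u = v\<rbrakk> \<Longrightarrow> \<phi> g v \<noteq> u"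
begin

section \<open>Stabilisation in terms of vertices\<close>

text \<open>Every point of the image is an affine combination of vertices in the image, so fixing
  those vertices suffices.\<close>

lemma pointwise_stabiliser_ray:
  assumes x: "ray x"
    and I: "I = {real m..} \<or> I = {real m..real n}"
  shows "pointwise_stabiliser G V \<phi> (ray_point x ` I) = {g \<in> carrier G. \<forall>i. real i \<in> I \<longrightarrow> \<phi> g (x i) = x i}"
proof (intro equalityI subsetI)
  fix g assume g: "g \<in> pointwise_stabiliser G V \<phi> (ray_point x ` I)"
  then have gc: "g \<in> carrier G" by (simp add: pointwise_stabiliser_def)
  have "\<phi> g (x i) = x i" if "real i \<in> I" for i
  proof -
    have "realised_action G V \<phi> g (indicator {x i}) = indicator {x i}"
      using g that ray_point_nat[of x i] by (fastforce simp: pointwise_stabiliser_def)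
    then have "indicator {\<phi> g (x i)} = (indicator {x i} :: 'v \<Rightarrow> real)"
      using realised_action_vertex[OF group_action_axioms gc ray_in[OF x]] by simp
    then have "indicator {\<phi> g (x i)} (x i) = (1 :: real)" by simp
    then show ?thesis by (simp add: indicator_def split: if_splits)
  qed
  then show "g \<in> {g \<in> carrier G. \<forall>i. real i \<in> I \<longrightarrow> \<phi> g (x i) = x i}" using gc by simp
next
  fix g assume g: "g \<in> {g \<in> carrier G. \<forall>i. real i \<in> I \<longrightarrow> \<phi> g (x i) = x i}"
  have ind: "indicator {x i} (\<phi> (inv g) v) = (indicator {x i} v :: real)"
    if "real i \<in> I" "v \<in> V" for i v
    using fun_cong[OF realised_action_vertex[OF group_action_axioms, of g "x i"], of v] g that ray_in[OF x]
    by (simp add: realised_action_def)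
  have ind0: "indicator {x i} v = (0 :: real)" if "v \<notin> V" for i v
    using ray_in[OF x, of i] that by (auto simp: indicator_def)
  have "realised_action G V \<phi> g (ray_point x t) = ray_point x t" if t: "t \<in> I" for t
  proof -
    have t0: "0 \<le> t" "real m \<le> t" using t I by auto
    define i where "i = nat \<lfloor>t\<rfloor>"
    have i: "real i \<le> t" "t < real i + 1" using t0 unfolding i_def by linarith+
    have "real i \<in> I" using i t I by auto
    \<comment> \<open>The bounds of \<open>I\<close> are integers, so the edge containing a
      non-integral \<open>t\<close> has its far end in \<open>I\<close> too.\<close>
    moreover have "real (Suc i) \<in> I" if "t \<noteq> real i"
    proof -
      have "real i < t" using i that by simp
      then have "Suc i \<le> n" if "t \<le> real n" using that by linarith
      then show ?thesis using i t I by auto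
    qed
    ultimately show ?thesis
      using ind[of i] ind[of "Suc i"] ind0 i
      by (cases "t = real i") (auto simp: fun_eq_iff realised_action_def ray_point_eq[of i t] ray_point_nat)
  qed
  then show "g \<in> pointwise_stabiliser G V \<phi> (ray_point x ` I)"
    using g by (auto simp: pointwise_stabiliser_def)
qed

text \<open>The tails are a decreasing sequence of geodesics, all of infinite length. The resulting
  \<open>N\<close> serves all group elements at once.\<close>

lemma stabiliser_tails_stabilise:
  assumes "stabilisation_property G V E \<phi>" "ray x"
  shows "\<exists>N. \<forall>n\<ge>N. \<forall>g\<in>carrier G. (\<forall>i\<ge>n. \<phi> g (x i) = x i) \<longrightarrow> (\<forall>i\<ge>N. \<phi> g (x i) = x i)"
proof -
  define S where "S n = {g \<in> carrier G. \<forall>i\<ge>n. \<phi> g (x i) = x i}" for n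
  have top: "emeasure lborel {real n..} = \<infinity>" for n
  proof (rule ccontr)
    assume "emeasure lborel {real n..} \<noteq> \<infinity>"
    then obtain r where r: "0 \<le> r" "emeasure lborel {real n..} = ennreal r"
      by (cases "emeasure lborel {real n..}") auto
    obtain k :: nat where k: "r < real k" using reals_Archimedean2 by blast
    have "emeasure lborel {real n..real n + real k} \<le> emeasure lborel {real n..}"
      by (intro emeasure_mono) auto
    then show False using r k by (simp add: ennreal_le_iff)
  qed
  have "\<exists>N. \<forall>n\<ge>N. pointwise_stabiliser G V \<phi> (ray_point x ` {real n..}) =
      pointwise_stabiliser G V \<phi> (ray_point x ` {real (Suc n)..})"
    by (rule assms(1)[unfolded stabilisation_property_def, rule_format,
          of "\<lambda>n. {real n..}" "\<lambda>_. ray_point x"])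
      (use assms(2) in \<open>auto intro!: ray_point_geodesic image_mono simp: is_interval_ci top\<close>)
  moreover have "pointwise_stabiliser G V \<phi> (ray_point x ` {real n..}) = S n" for n
    by (subst pointwise_stabiliser_ray[OF assms(2)]) (auto simp: S_def)
  ultimately obtain N where eq: "\<And>n. n \<ge> N \<Longrightarrow> S n = S (Suc n)" by metis
  have "S n = S N" if "n \<ge> N" for n
    using that by (induction rule: dec_induct) (simp, metis eq)
  then show ?thesis unfolding S_def by blast
qed

text \<open>Here the stabilisation property is applied to the increasing initial segments; from
  \<open>N\<close> on all their stabilisers coincide.\<close>

lemma stabiliser_segments_stabilise:
  assumes "stabilisation_property G V E \<phi>" "ray x"
  shows "\<exists>N. \<forall>g\<in>carrier G. (\<forall>i\<le>N. \<phi> g (x i) = x i) \<longrightarrow> (\<forall>i. \<phi> g (x i) = x i)"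
proof -
  define S where "S n = {g \<in> carrier G. \<forall>i\<le>n. \<phi> g (x i) = x i}" for n
  have "\<exists>N. \<forall>n\<ge>N. pointwise_stabiliser G V \<phi> (ray_point x ` {real 0..real n}) =
      pointwise_stabiliser G V \<phi> (ray_point x ` {real 0..real (Suc n)})"
  proof (rule assms(1)[unfolded stabilisation_property_def, rule_format,
          of "\<lambda>n. {real 0..real n}" "\<lambda>_. ray_point x"])
    have "(\<lambda>n. ennreal (real n)) \<longlonglongrightarrow> \<infinity>"
      by (simp add: ennreal_tendsto_top_eq_at_top filterlim_real_sequentially)
    then show "(\<lambda>n. emeasure lborel {real 0..real n}) \<longlonglongrightarrow> \<infinity>" by simp
  qed (use assms(2) in \<open>auto intro!: ray_point_geodesic image_mono simp: is_interval_cc\<close>)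
  moreover have "pointwise_stabiliser G V \<phi> (ray_point x ` {real 0..real n}) = S n" for n
    by (subst pointwise_stabiliser_ray[OF assms(2)]) (auto simp: S_def)
  ultimately obtain N where eq: "\<And>n. n \<ge> N \<Longrightarrow> S n = S (Suc n)" by metis
  have SN: "S n = S N" if "n \<ge> N" for n
    using that by (induction rule: dec_induct) (simp, metis eq)
  have "\<phi> g (x i) = x i" if "g \<in> S N" for g i
  proof -
    have "g \<in> S (max N i)" using that SN[of "max N i"] by simp
    then show ?thesis by (simp add: S_def)
  qed
  then show ?thesis unfolding S_def by blast
qed

section \<open>Isometries of the vertex set and fixed vertices\<close>

text \<open>Walks map to walks, so no distance grows under any element; the inverse gives
  equality.\<close>

lemma gdist_action:
  assumes "g \<in> carrier G" "u \<in> V" "v \<in> V"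
  shows "gdist (\<phi> g u) (\<phi> g v) = gdist u v"
proof -
  interpret group G by (rule is_group)
  have walk: "(\<phi> h x, \<phi> h y) \<in> adj ^^ n" if "(x, y) \<in> adj ^^ n" "h \<in> carrier G" for h x y n
    using that(1)
  proof (induction n arbitrary: y)
    case (Suc n)
    then obtain z where z: "(x, z) \<in> adj ^^ n" "(z, y) \<in> adj" by auto
    then have "(\<phi> h z, \<phi> h y) \<in> adj"
      using adj_in[OF z(2)] preserves_edges[OF that(2)] by (simp add: adj_def)
    then show ?case using Suc.IH[OF z(1)] by auto
  qed simp
  have le: "gdist (\<phi> h x) (\<phi> h y) \<le> gdist x y" if "x \<in> V" "y \<in> V" "h \<in> carrier G" for h x y
    using gdist_le[OF walk[OF gdist_walk[OF that(1,2)] that(3)]] by simp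
  have "\<phi> (inv g) (\<phi> g u) = u" "\<phi> (inv g) (\<phi> g v) = v"
    using assms orbit_sym_aux by auto
  then show ?thesis
    using le[OF assms(2,3,1)] le[of "\<phi> g u" "\<phi> g v" "inv g"] assms action_closed by auto
qed

lemma btw_action:
  assumes "g \<in> carrier G" "u \<in> V" "m \<in> V" "v \<in> V"
  shows "btw (\<phi> g u) (\<phi> g m) (\<phi> g v) \<longleftrightarrow> btw u m v"
  using assms by (simp add: btw_def gdist_action)

lemma gprod_action:
  assumes "g \<in> carrier G" "p \<in> V" "x \<in> V" "y \<in> V"
  shows "gprod (\<phi> g p) (\<phi> g x) (\<phi> g y) = gprod p x y"
  using assms by (simp add: gprod_def gdist_action)

lemma ray_action:
  assumes "g \<in> carrier G" "ray x"
  shows "ray (\<lambda>i. \<phi> g (x i))"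
  using assms by (auto simp: ray_def gdist_action action_closed)

lemma inv_action:
  assumes "g \<in> carrier G" "v \<in> V"
  shows "\<phi> (inv g) (\<phi> g v) = v" "\<phi> g (\<phi> (inv g) v) = v"
proof -
  interpret group G by (rule is_group)
  show "\<phi> (inv g) (\<phi> g v) = v" using orbit_sym_aux[OF assms] by simp
  show "\<phi> g (\<phi> (inv g) v) = v" using orbit_sym_aux[of "inv g" v] assms by simp
qed

lemma pow_action_Suc:
  assumes "g \<in> carrier G" "v \<in> V"
  shows "\<phi> (g [^] Suc n) v = \<phi> g (\<phi> (g [^] n) v)" "\<phi> (g [^] Suc n) v = \<phi> (g [^] n) (\<phi> g v)"
proof -
  interpret group G by (rule is_group)
  show "\<phi> (g [^] Suc n) v = \<phi> g (\<phi> (g [^] n) v)"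
    using assms by (simp only: nat_pow_Suc2) (simp add: composition_rule)
  show "\<phi> (g [^] Suc n) v = \<phi> (g [^] n) (\<phi> g v)"
    using assms by (simp add: composition_rule)
qed

lemma fixed_int_pow:
  assumes "g \<in> carrier G" "v \<in> V" "\<phi> g v = v"
  shows "\<phi> (g [^] (k::int)) v = v"
proof -
  interpret group G by (rule is_group)
  have pow: "\<phi> (g [^] (n::nat)) v = v" for n
    by (induction n) (use assms in \<open>simp_all add: action_one composition_rule\<close>)
  show ?thesis
  proof (cases k rule: int_cases2)
    case (nonneg n)
    then show ?thesis using pow by (simp add: int_pow_int)
  next
    case (nonpos n)
    then show ?thesis
      using inv_action(1)[of "g [^] n" v] pow[of n] assms by (simp add: int_pow_neg_int)
  qed
qed

lemma fixed_int_pow_mult: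
  fixes j k :: int
  assumes "g \<in> carrier G" "v \<in> V" "\<phi> (g [^] j) v = v"
  shows "\<phi> (g [^] (j * k)) v = v"
  using fixed_int_pow[of "g [^] j" v k] assms is_group
  by (simp add: group.int_pow_pow group.int_pow_closed)

text \<open>The geodesic from \<open>p\<close> to \<open>v\<close> passes through \<open>q\<close>
  and so starts with the neighbour \<open>s\<close> of \<open>p\<close> towards \<open>q\<close>.
  The geodesic from \<open>p\<close> to \<open>\<phi> f v\<close> starts with the image of
  \<open>s\<close>, a different vertex, so it leaves \<open>p\<close> in another direction than
  \<open>q\<close>.\<close>

lemma elliptic_ping_pong:
  assumes f: "f \<in> carrier G" "\<phi> f p = p" and V: "p \<in> V" "q \<in> V" "v \<in> V" and "p \<noteq> q"
    and moves: "\<And>s. s \<in> V \<Longrightarrow> gdist p s = 1 \<Longrightarrow> btw p s q \<Longrightarrow> \<phi> f s \<noteq> s"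
    and b: "btw v q p"
  shows "btw (\<phi> f v) p q"
proof (rule ccontr)
  assume nb: "\<not> btw (\<phi> f v) p q"
  obtain s where s: "s \<in> V" "gdist p s = 1" "gdist s q = gdist p q - 1"
    using step_towards[OF V(1,2) \<open>p \<noteq> q\<close>] by blast
  then have sq: "btw p s q" by (simp add: btw_def)
  have fv: "\<phi> f v \<in> V" using action_closed f V by blast
  have "btw p q v" using b btw_commute by blast
  then have "btw p s v" using btw_trans[OF V(1) s(1) V(2,3) sq] by blast
  then have fs: "btw p (\<phi> f s) (\<phi> f v)" using btw_action[OF f(1) V(1) s(1) V(3)] f(2) by simp
  obtain m where m: "m \<in> V" "btw p m (\<phi> f v)" "btw p m q" "btw (\<phi> f v) m q"
    using median[OF V(1) fv V(2)] by blast
  have "m \<noteq> p" using nb m(4) by blast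
  then have "gdist p m \<noteq> 0" using gdist_eq_0[OF V(1) m(1)] by auto
  then have "gdist p m \<ge> 1" using gdist_nonneg[of p m] by linarith
  then have "2 * gdist p s \<le> gprod p q (\<phi> f v)"
    using btw_median_gprod[OF m(2-4)] s(2) gprod_commute[of p q] by simp
  moreover have "gdist p s = gdist p (\<phi> f s)" using gdist_action[OF f(1) V(1) s(1)] f(2) by simp
  ultimately have "s = \<phi> f s"
    using branches_coincide[OF V(1) s(1) action_closed[OF f(1) s(1)] V(2) fv sq fs] by blast
  then show False using moves[OF s(1,2) sq] by simp
qed

section \<open>Elements without fixed vertices are translations\<close>

text \<open>
  At a vertex of least displacement, a backtrack of \<open>[v, g v, g\<^sup>2 v]\<close> would give a vertex of
  smaller displacement, a fixed vertex, or an inverted edge in the middle of \<open>[v, g v]\<close>.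
\<close>

lemma no_backtrack_at_least_displacement:
  assumes g: "g \<in> carrier G" and v: "v \<in> V"
    and least: "\<And>u. u \<in> V \<Longrightarrow> gdist v (\<phi> g v) \<le> gdist u (\<phi> g u)"
    and nofix: "\<And>u. u \<in> V \<Longrightarrow> \<phi> g u \<noteq> u"
  shows "gprod (\<phi> g v) v (\<phi> g (\<phi> g v)) = 0"
proof (rule ccontr)
  let ?w = "\<phi> g v" and ?l = "gdist v (\<phi> g v)"
  assume "gprod ?w v (\<phi> g ?w) \<noteq> 0"
  have V: "?w \<in> V" "\<phi> g ?w \<in> V" using action_closed[OF g] v by auto
  obtain m where m: "m \<in> V" "btw ?w m v" "btw ?w m (\<phi> g ?w)" "btw v m (\<phi> g ?w)"
    using median[of ?w v "\<phi> g ?w"] V v by blast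
  define k where "k = gdist ?w m"
  have gp: "gprod ?w v (\<phi> g ?w) = 2 * k" using btw_median_gprod[OF m(2-4)] by (simp add: k_def)
  then have k: "k > 0" using \<open>gprod ?w v (\<phi> g ?w) \<noteq> 0\<close> by (simp add: k_def less_le)
  have kl: "k \<le> ?l" using m(2) gdist_nonneg[of m v] gdist_commute[of v ?w] unfolding btw_def k_def by linarith
  \<comment> \<open>The geodesics from \<open>?w\<close> to \<open>v\<close> and to the image of
    \<open>?w\<close> share their first \<open>k\<close> edges. The image of the vertex at distance
    \<open>j\<close> from \<open>v\<close> lies on the second one, hence equals the vertex
    \<open>y'\<close> at distance \<open>j\<close> from \<open>?w\<close> on the first.\<close>
  have key: "\<exists>y y'. y \<in> V \<and> y' \<in> V \<and> btw ?w y v \<and> btw ?w y' v \<and> gdist v y = j \<and> gdist ?w y' = j \<and>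
      \<phi> g y = y' \<and> gdist y y' \<le> ?l - 2 * j" if j: "0 \<le> j" "j \<le> k" "2 * j \<le> ?l" for j
  proof -
    obtain y where y: "y \<in> V" "gdist v y = j" "gdist y ?w = ?l - j"
      using geodesic_point[of v ?w j] v V j kl by auto
    obtain y' where y': "y' \<in> V" "gdist ?w y' = j" "gdist y' v = ?l - j"
      using geodesic_point[of ?w v j] v V j kl by (auto simp: gdist_commute)
    have b: "btw ?w y v" "btw ?w y' v" "btw v y ?w"
      using y y' by (auto simp: btw_def gdist_commute)
    have "btw ?w (\<phi> g y) (\<phi> g ?w)" using btw_action[OF g v y(1) V(1)] b(3) by simp
    moreover have "gdist ?w (\<phi> g y) = j" using gdist_action[OF g v y(1)] y by simp
    ultimately have "y' = \<phi> g y"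
      using branches_coincide[OF V(1) y'(1) action_closed[OF g y(1)] v V(2) b(2)] y'(2) gp j(2) by simp
    moreover have "gdist y y' \<le> ?l - 2 * j"
    proof -
      have "btw v y' ?w" using b(2) btw_commute by blast
      then have "btw v y y'" using btw_le_btw[OF v y(1) y'(1) V(1) b(3)] y y' j by (simp add: gdist_commute)
      then show ?thesis using y y' by (simp add: btw_def gdist_commute)
    qed
    ultimately show ?thesis using y y' b by blast
  qed
  show False
  proof (cases "2 * k \<le> ?l")
    case True
    then obtain y where "y \<in> V" "gdist y (\<phi> g y) \<le> ?l - 2 * k" using key[of k] k by auto
    then show False using least[of y] k by simp
  next
    case False
    \<comment> \<open>With \<open>2 * k > ?l\<close> the pair can be pushed to the middle of the
      geodesic. As no vertex is fixed, \<open>?l\<close> is odd and \<open>y\<close>,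
      \<open>y'\<close> span the middle edge; since \<open>j + 1\<close> is still at most
      \<open>k\<close>, the same argument sends \<open>y'\<close> back to \<open>y\<close>.\<close>
    define j where "j = ?l div 2"
    have jb: "0 \<le> j" "j \<le> k" "2 * j \<le> ?l" "?l \<le> 2 * j + 1"
      using False gdist_nonneg[of v ?w] unfolding j_def by linarith+
    obtain y y' where y: "y \<in> V" "y' \<in> V" "btw ?w y v" "btw ?w y' v" "gdist v y = j" "gdist ?w y' = j"
      "\<phi> g y = y'" "gdist y y' \<le> ?l - 2 * j" using key[OF jb(1-3)] by blast
    have "gdist y y' \<noteq> 0" using nofix[OF y(1)] y(1,2,7) gdist_eq_0 by metis
    then have one: "gdist y y' = 1" "?l = 2 * j + 1" using y(8) jb gdist_nonneg[of y y'] by linarith+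
    then have E: "{y, y'} \<in> E" using gdist_eq_1[OF y(1,2)] by (simp add: adj_def)
    have "btw ?w (\<phi> g y') (\<phi> g ?w)"
      using btw_action[OF g v y(2) V(1)] y(4) btw_commute by simp
    moreover have "gdist ?w (\<phi> g y') = j + 1"
      using gdist_action[OF g v y(2)] y(4,6) one by (simp add: btw_def gdist_commute)
    moreover have "gdist ?w y = j + 1" using y(3,5) one by (simp add: btw_def gdist_commute)
    moreover have "j + 1 \<le> k" using False one by linarith
    ultimately have "y = \<phi> g y'"
      using branches_coincide[OF V(1) y(1) action_closed[OF g y(2)] v V(2) y(3)] gp by simp
    then show False using no_inversions[OF g E y(7)] by simp
  qed
qed

text \<open>At a vertex of least displacement consecutive translates do not backtrack. In a tree
  this local condition makes the whole forward orbit lie on a geodesic.\<close>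

lemma fixed_or_translation:
  assumes g: "g \<in> carrier G" and nofix: "\<And>u. u \<in> V \<Longrightarrow> \<phi> g u \<noteq> u"
  obtains v l where "v \<in> V" "l > 0" "\<And>n::nat. gdist v (\<phi> (g [^] n) v) = int n * l"
proof -
  interpret group G by (rule is_group)
  obtain u0 where "u0 \<in> V" using nonempty by blast
  then obtain v where v: "v \<in> V" and "\<And>u. u \<in> V \<Longrightarrow> nat (gdist v (\<phi> g v)) \<le> nat (gdist u (\<phi> g u))"
    using ex_has_least_nat[of "\<lambda>u. u \<in> V" u0 "\<lambda>u. nat (gdist u (\<phi> g u))"] by blast
  then have least: "gdist v (\<phi> g v) \<le> gdist u (\<phi> g u)" if "u \<in> V" for u
    using that by (simp add: nat_le_iff)
  define l where "l = gdist v (\<phi> g v)"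
  have w: "\<phi> g v \<in> V" using action_closed g v by blast
  then have l: "l > 0" using gdist_eq_0[OF v w] nofix[OF v] by (simp add: l_def less_le)
  have P: "\<phi> (g [^] (n::nat)) v \<in> V" for n using action_closed g v by simp
  have gp0: "gprod (\<phi> g v) v (\<phi> g (\<phi> g v)) = 0"
    by (rule no_backtrack_at_least_displacement[OF g v least nofix])
  have step: "gdist (\<phi> (g [^] n) v) (\<phi> (g [^] Suc n) v) = l" for n
    using gdist_action[of "g [^] n" v "\<phi> g v"] g v w pow_action_Suc(2)[OF g v] by (simp add: l_def)
  \<comment> \<open>Two consecutive distances are carried along, since the product at the newest
    vertex involves both.\<close>
  have "gdist v (\<phi> (g [^] n) v) = int n * l \<and> gdist v (\<phi> (g [^] Suc n) v) = int (Suc n) * l" for n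
  proof (induction n)
    case 0
    show ?case using g v by (simp add: action_one l_def)
  next
    case (Suc n)
    let ?p = "\<phi> (g [^] Suc n) v" and ?a = "\<phi> (g [^] n) v" and ?b = "\<phi> (g [^] Suc (Suc n)) v"
    have "?p = \<phi> (g [^] n) (\<phi> g v)" "?b = \<phi> (g [^] n) (\<phi> g (\<phi> g v))"
      using pow_action_Suc(2)[OF g v] pow_action_Suc(2)[OF g w] pow_action_Suc(2)[OF g v, of "Suc n"] by simp_all
    then have "gprod ?p ?a ?b = 0"
      using gprod_action[of "g [^] n" "\<phi> g v" v "\<phi> g (\<phi> g v)"] gp0 g v w action_closed by simp
    moreover have "gprod ?p ?a v = 2 * l"
      using Suc step[of n] by (simp add: gprod_def gdist_commute algebra_simps)
    \<comment> \<open>The product of \<open>?a\<close> and \<open>?b\<close> is zero while that of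
      \<open>?a\<close> and \<open>v\<close> is positive, so the minimum in the four-point
      inequality must be the remaining product.\<close>
    ultimately have "gprod ?p v ?b \<le> 0"
      using four_point[OF P[of "Suc n"] P[of n] v P[of "Suc (Suc n)"]] l by linarith
    then have "gprod ?p v ?b = 0" using gprod_nonneg[OF P v P, of "Suc n" "Suc (Suc n)"] by linarith
    then show ?case
      using Suc step[of "Suc n"] by (simp add: gprod_def gdist_commute algebra_simps)
  qed
  then show thesis using that[OF v l] by blast
qed

section \<open>Ends of a translation and its dynamics\<close>

text \<open>The element fixes the end of the ray and moves by \<open>k\<close> towards it. Two
  offsets are used because indices are natural numbers while \<open>k\<close> may be
  negative.\<close>

definition shifts_ray :: "(nat \<Rightarrow> 'v) \<Rightarrow> 'a \<Rightarrow> int \<Rightarrow> bool"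
  where "shifts_ray x g k \<longleftrightarrow> (\<exists>a b. int b - int a = k \<and> (\<forall>i. \<phi> g (x (a + i)) = x (b + i)))"

text \<open>The orbit of \<open>p\<close> stays at constant distance \<open>D\<close> from that of
  \<open>v\<close>, so its Gromov products grow linearly and it converges to an end. The image of
  the limit ray under \<open>h\<close> converges to the same end and therefore merges with
  it.\<close>

lemma translation_ray:
  assumes h: "h \<in> carrier G" and p: "p \<in> V" and v: "v \<in> V" and l: "l > 0"
    and trans: "\<And>n::nat. gdist v (\<phi> (h [^] n) v) = int n * l"
  obtains u where "ray u" "u 0 = p" "\<And>K. \<exists>N::nat. \<forall>n\<ge>N. btw p (u K) (\<phi> (h [^] n) p)"
    "\<exists>k. shifts_ray u h k"
proof -
  interpret group G by (rule is_group)
  define z where "z n = \<phi> (h [^] (n::nat)) p" for n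
  have z: "z n \<in> V" for n using action_closed h p by (simp add: z_def)
  have zv: "\<phi> (h [^] (n::nat)) v \<in> V" for n using action_closed h v by simp
  define D where "D = gdist p v"
  have D: "gdist (z n) (\<phi> (h [^] n) v) = D" for n
    using gdist_action[of "h [^] n" p v] h p v by (simp add: z_def D_def)
  have near: "\<bar>gdist p (z n) - int n * l\<bar> \<le> 2 * D" for n
    using gdist_triangle[OF p v zv, of n] gdist_triangle[OF p zv z, of n n]
      gdist_triangle[OF v p zv, of n] gdist_triangle[OF p z zv, of n n] D[of n] trans[of n]
    by (auto simp: D_def gdist_commute)
  have zz: "gdist (z m) (z (m + j)) = gdist p (z j)" for m j
    using gdist_action[of "h [^] m" p "z j"] h p z composition_rule[OF p, of "h [^] m" "h [^] j"]
    by (simp add: z_def nat_pow_mult)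
  \<comment> \<open>Each of the three distances in the product deviates by at most
    \<open>2 * D\<close> from the corresponding multiple of \<open>l\<close>, whence the total error
    \<open>6 * D\<close>.\<close>
  have gp: "2 * (int m * l) - 6 * D \<le> gprod p (z m) (z n)" if "m \<le> n" for m n
  proof -
    have "gdist (z m) (z n) = gdist p (z (n - m))" using zz[of m "n - m"] that by simp
    moreover have "int (n - m) * l = int n * l - int m * l"
      using that by (simp add: of_nat_diff left_diff_distrib)
    ultimately show ?thesis using near[of m] near[of n] near[of "n - m"] by (simp add: gprod_def)
  qed
  have cauchy: "\<exists>N. \<forall>m\<ge>N. \<forall>n\<ge>N. 2 * int K \<le> gprod p (z m) (z n)" for K
  proof (intro exI allI impI)
    fix m n assume mn: "m \<ge> K + nat (3 * D)" "n \<ge> K + nat (3 * D)"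
    have big: "int i * l \<ge> int K + 3 * D" if "i \<ge> K + nat (3 * D)" for i
    proof -
      have "int i \<ge> int K + 3 * D" using that by linarith
      moreover have "int i * 1 \<le> int i * l" using l by (intro mult_left_mono) auto
      ultimately show ?thesis by linarith
    qed
    show "2 * int K \<le> gprod p (z m) (z n)"
    proof (cases "m \<le> n")
      case True
      then show ?thesis using gp[of m n] big[OF mn(1)] by linarith
    next
      case False
      then show ?thesis using gp[of n m] big[OF mn(2)] gprod_commute[of p "z m" "z n"] by linarith
    qed
  qed
  obtain u where u: "ray u" "u 0 = p" "\<And>K. \<exists>N. \<forall>n\<ge>N. btw p (u K) (z n)"
    using sequence_ray[OF p z cauchy] by blast
  \<comment> \<open>The image ray follows the same orbit, delayed by one index.\<close>
  have "\<exists>N. \<forall>n\<ge>N. btw (\<phi> h (u 0)) (\<phi> h (u K)) (z n)" for K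
  proof -
    obtain N where N: "\<And>n. n \<ge> N \<Longrightarrow> btw p (u K) (z n)" using u(3) by blast
    have "btw (\<phi> h (u 0)) (\<phi> h (u K)) (z n)" if n: "n \<ge> Suc N" for n
    proof -
      obtain n' where n': "n = Suc n'" "n' \<ge> N" using n by (cases n) auto
      have "z n = \<phi> h (z n')" using pow_action_Suc(1)[OF h p] by (simp add: z_def n')
      then show ?thesis using btw_action[OF h p ray_in[OF u(1)] z] N[OF n'(2)] u(2) by simp
    qed
    then show ?thesis by blast
  qed
  then obtain a b where "\<And>i. \<phi> h (u (a + i)) = u (b + i)"
    using rays_to_same_sequence_merge[OF u(1) _ ray_action[OF h u(1)], of z] u(2,3) z by metis
  then have "\<exists>k. shifts_ray u h k" unfolding shifts_ray_def by blast
  then show thesis using that[OF u(1,2)] u(3) by (simp add: z_def)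
qed

lemma translation_inv:
  assumes h: "h \<in> carrier G" and v: "v \<in> V"
    and trans: "\<And>n::nat. gdist v (\<phi> (h [^] n) v) = int n * l"
  shows "gdist v (\<phi> (inv h [^] (n::nat)) v) = int n * l"
proof -
  interpret group G by (rule is_group)
  have "\<phi> (h [^] n) (\<phi> (inv h [^] n) v) = v"
    using h v inv_action(2)[of "h [^] n" v] by (simp add: nat_pow_inv)
  then show ?thesis
    using gdist_action[of "h [^] n" v "\<phi> (inv h [^] n) v"] trans[of n] h v action_closed
    by (simp add: gdist_commute)
qed

text \<open>A vertex not beyond \<open>t\<close> has a small Gromov product with the far backward
  orbit of \<open>p\<close>. Applying \<open>h [^] n\<close> turns this into a large product with
  the far forward orbit, which lies beyond \<open>s\<close>. The bound on \<open>n\<close> does not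
  depend on the vertex.\<close>

lemma translation_north_south:
  assumes h: "h \<in> carrier G" and p: "p \<in> V" and v: "v \<in> V" and l: "l > 0"
    and trans: "\<And>n::nat. gdist v (\<phi> (h [^] n) v) = int n * l"
    and s: "s \<in> V" "\<exists>N. \<forall>n\<ge>N. btw p s (\<phi> (h [^] (n::nat)) p)"
    and t: "t \<in> V" "gdist p t = gdist p s" "\<exists>N. \<forall>n\<ge>N. btw p t (\<phi> (inv h [^] (n::nat)) p)"
  shows "\<exists>M. \<forall>n::nat\<ge>M. \<forall>y\<in>V. \<not> btw p t y \<longrightarrow> btw p s (\<phi> (h [^] n) y)"
proof -
  interpret group G by (rule is_group)
  obtain N1 :: nat where N1: "\<And>n. n \<ge> N1 \<Longrightarrow> btw p s (\<phi> (h [^] n) p)" using s(2) by blast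
  obtain N2 :: nat where N2: "\<And>n. n \<ge> N2 \<Longrightarrow> btw p t (\<phi> (inv h [^] n) p)" using t(3) by blast
  define K where "K = gdist p s"
  define D where "D = gdist p v"
  have "btw p s (\<phi> (h [^] n) y)"
    if n: "n \<ge> max (max N1 N2) (nat (2 * K + 2 * D))" and y: "y \<in> V" "\<not> btw p t y" for n y
  proof -
    have hn: "h [^] n \<in> carrier G" "inv h [^] n \<in> carrier G" using h by auto
    let ?a = "\<phi> (h [^] n)" and ?q = "\<phi> (inv h [^] n) p"
    have V: "?a p \<in> V" "?a y \<in> V" "?q \<in> V" "?a v \<in> V" using action_closed hn p y v by auto
    have aq: "?a ?q = p" using h p inv_action(2)[of "h [^] n" p] by (simp add: nat_pow_inv)
    have lt: "gprod p y ?q < 2 * K"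
    proof (rule ccontr)
      assume "\<not> gprod p y ?q < 2 * K"
      then have "btw p t y"
        using btw_gprod_transfer[OF p t(1) V(3) y(1)] N2[of n] n t(2)
        by (simp add: K_def gprod_commute)
      then show False using y(2) by simp
    qed
    have "int n * 1 \<le> int n * l" using l by (intro mult_left_mono) auto
    then have "int n * l \<ge> 2 * K + 2 * D" using n by linarith
    moreover have "gdist v (?a v) \<le> gdist p (?a p) + 2 * D"
      using gdist_triangle[OF v p V(4)] gdist_triangle[OF p V(1) V(4)] gdist_action[OF hn(1) p v]
      by (simp add: D_def gdist_commute)
    ultimately have far: "gdist p (?a p) \<ge> 2 * K" using trans[of n] by linarith
    have "gprod (?a p) (?a y) p = gprod p y ?q"
      using gprod_action[OF hn(1) p y(1) V(3)] aq by simp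
    \<comment> \<open>The products of \<open>?a y\<close> with \<open>p\<close> based at
      \<open>?a p\<close>, and with \<open>?a p\<close> based at \<open>p\<close>, add up to twice
      the distance from \<open>p\<close> to \<open>?a p\<close>.\<close>
    then have "2 * K \<le> gprod p (?a p) (?a y)"
      using lt far by (simp add: gprod_def gdist_commute)
    then show ?thesis
      using btw_gprod_transfer[OF p s(1) V(1,2)] N1[of n] n by (simp add: K_def)
  qed
  then show ?thesis by blast
qed

text \<open>The vertices beyond the \<open>K\<close>-th vertex of one of two rays; both rays are
  always taken with the same origin.\<close>

definition cone :: "(nat \<Rightarrow> 'v) \<Rightarrow> (nat \<Rightarrow> 'v) \<Rightarrow> nat \<Rightarrow> 'v set"
  where "cone u u' K = {y \<in> V. btw (u 0) (u K) y \<or> btw (u 0) (u' K) y}"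

text \<open>The ray \<open>u\<close> comes from the positive powers of \<open>h\<close> and
  \<open>u'\<close> from the negative ones. Uniting both half-trees makes the statement symmetric
  under inversion of \<open>h\<close>, so it covers all exponents of large absolute value.\<close>

lemma hyperbolic_rays:
  assumes h: "h \<in> carrier G" and nofix: "\<And>u. u \<in> V \<Longrightarrow> \<phi> h u \<noteq> u" and p: "p \<in> V"
  obtains u u' where "ray u" "ray u'" "u 0 = p" "u' 0 = p"
    "\<exists>k. shifts_ray u h k" "\<exists>k. shifts_ray u' h k"
    "\<And>K. \<exists>M::nat. M \<ge> 1 \<and> (\<forall>k::int. \<bar>k\<bar> \<ge> int M \<longrightarrow> \<phi> (h [^] k) ` (V - cone u u' K) \<subseteq> cone u u' K)"
proof -
  interpret group G by (rule is_group)
  obtain v l where v: "v \<in> V" and l: "l > 0" and trans: "\<And>n::nat. gdist v (\<phi> (h [^] n) v) = int n * l"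
    using fixed_or_translation[OF h nofix] by blast
  have ih: "inv h \<in> carrier G" using h by simp
  note trans' = translation_inv[OF h v trans]
  obtain u where u: "ray u" "u 0 = p" "\<And>K. \<exists>N::nat. \<forall>n\<ge>N. btw p (u K) (\<phi> (h [^] n) p)"
    "\<exists>k. shifts_ray u h k" using translation_ray[OF h p v l trans] by blast
  obtain u' where u': "ray u'" "u' 0 = p" "\<And>K. \<exists>N::nat. \<forall>n\<ge>N. btw p (u' K) (\<phi> (inv h [^] n) p)"
    "\<exists>k. shifts_ray u' (inv h) k" using translation_ray[OF ih p v l trans'] by blast
  obtain k a b where "int b - int a = k" "\<And>i. \<phi> (inv h) (u' (a + i)) = u' (b + i)"
    using u'(4) unfolding shifts_ray_def by blast
  then have "\<phi> h (u' (b + i)) = u' (a + i)" for i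
    using inv_action(2)[OF h ray_in[OF u'(1)]] by metis
  then have sh: "\<exists>k. shifts_ray u' h k" unfolding shifts_ray_def by blast
  have dist: "gdist p (u K) = int K" "gdist p (u' K) = int K" for K
    using ray_gdist[OF u(1), of 0 K] ray_gdist[OF u'(1), of 0 K] u(2) u'(2) by auto
  have "\<exists>M::nat. M \<ge> 1 \<and> (\<forall>k::int. \<bar>k\<bar> \<ge> int M \<longrightarrow> \<phi> (h [^] k) ` (V - cone u u' K) \<subseteq> cone u u' K)" for K
  proof -
    obtain M1 where M1: "\<And>n y. n \<ge> M1 \<Longrightarrow> y \<in> V \<Longrightarrow> \<not> btw p (u' K) y \<Longrightarrow> btw p (u K) (\<phi> (h [^] (n::nat)) y)"
      using translation_north_south[OF h p v l trans ray_in[OF u(1)] u(3) ray_in[OF u'(1)] _ u'(3)] dist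
      by metis
    obtain M2 where M2: "\<And>n y. n \<ge> M2 \<Longrightarrow> y \<in> V \<Longrightarrow> \<not> btw p (u K) y \<Longrightarrow> btw p (u' K) (\<phi> (inv h [^] (n::nat)) y)"
      using translation_north_south[OF ih p v l trans' ray_in[OF u'(1)] u'(3) ray_in[OF u(1)] _ ] u(3) dist h
      by (metis inv_inv)
    have "\<phi> (h [^] k) y \<in> cone u u' K"
      if k: "\<bar>k\<bar> \<ge> int (max 1 (max M1 M2))" and y: "y \<in> V" "y \<notin> cone u u' K" for k y
    proof -
      have nb: "\<not> btw p (u K) y" "\<not> btw p (u' K) y" using y u(2) by (auto simp: cone_def)
      have "btw p (u K) (\<phi> (h [^] k) y) \<or> btw p (u' K) (\<phi> (h [^] k) y)"
      proof (cases "k \<ge> 0")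
        case True
        then have "h [^] k = h [^] nat k" by (metis int_nat_eq int_pow_int)
        then show ?thesis using M1[of "nat k" y] k True y nb by auto
      next
        case False
        define n where "n = nat (- k)"
        have kn: "k = - int n" using False by (simp add: n_def)
        then have "h [^] k = inv h [^] n" using int_pow_neg_int[OF h, of n] h by (simp add: nat_pow_inv)
        then show ?thesis using M2[of n y] k kn y nb by auto
      qed
      then show ?thesis using action_closed[of "h [^] k" y] h y u(2) by (simp add: cone_def)
    qed
    then show ?thesis by (intro exI[of _ "max 1 (max M1 M2)"]) auto
  qed
  then show thesis using that[OF u(1) u'(1) u(2) u'(2) u(4) sh] by blast
qed

end


section \<open>The law-power alternative\<close>

definition power_alternative ::
    "nat \<Rightarrow> nat letter list \<Rightarrow> ('g, 'm) monoid_scheme \<Rightarrow> 'g \<Rightarrow> 'g \<Rightarrow> bool"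
  where "power_alternative r w K g h \<longleftrightarrow> (\<exists>n::nat. n \<ge> 1 \<and>
      (subgroup_generated K {g [^]\<^bsub>K\<^esub> n, h [^]\<^bsub>K\<^esub> n} \<cong> free_group_rank 2 \<or>
       satisfies_law r w (subgroup_generated K {g [^]\<^bsub>K\<^esub> n, h [^]\<^bsub>K\<^esub> n})))"

lemma law_power_alternative_iff:
  "law_power_alternative r w K \<longleftrightarrow> (\<forall>g\<in>carrier K. \<forall>h\<in>carrier K. power_alternative r w K g h)"
  by (simp add: law_power_alternative_def power_alternative_def)

lemma power_alternative_commute: "power_alternative r w K g h \<longleftrightarrow> power_alternative r w K h g"
  by (simp add: power_alternative_def insert_commute)

context group
begin

lemma power_alternative_pow:
  assumes "g \<in> carrier G" "h \<in> carrier G" "M \<ge> 1"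
    and "power_alternative r w G (g [^] M) (h [^] (M::nat))"
  shows "power_alternative r w G g h"
proof -
  obtain n :: nat where n: "n \<ge> 1"
    "subgroup_generated G {g [^] (M * n), h [^] (M * n)} \<cong> free_group_rank 2 \<or>
     satisfies_law r w (subgroup_generated G {g [^] (M * n), h [^] (M * n)})"
    using assms by (auto simp: power_alternative_def nat_pow_pow)
  moreover have "M * n \<ge> 1" using n(1) assms(3) by simp
  ultimately show ?thesis unfolding power_alternative_def by blast
qed

text \<open>Powers and generated subgroups formed inside the subgroup are literally those formed in
  \<open>G\<close>, so the alternative is inherited.\<close>

lemma power_alternative_subgroup:
  assumes "law_power_alternative r w (subgroup_generated G A)"
    and "g \<in> carrier (subgroup_generated G A)" "h \<in> carrier (subgroup_generated G A)"
  shows "power_alternative r w G g h"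
proof -
  let ?H = "subgroup_generated G A"
  interpret H: group ?H by simp
  have eq: "subgroup_generated ?H {g [^] n, h [^] n} = subgroup_generated G {g [^] n, h [^] n}" for n :: nat
  proof -
    have "{g [^] n, h [^] n} \<subseteq> carrier ?H"
      using H.nat_pow_closed[OF assms(2), of n] H.nat_pow_closed[OF assms(3), of n]
      by (simp add: pow_subgroup_generated)
    moreover have "subgroup (carrier ?H) G" by (rule subgroup_subgroup_generated)
    moreover have "?H = G\<lparr>carrier := carrier ?H\<rparr>" by (simp add: subgroup_generated_def)
    ultimately have "generate ?H {g [^] n, h [^] n} = generate G {g [^] n, h [^] n}"
      using generate_consistent by metis
    moreover have "carrier ?H \<inter> {g [^] n, h [^] n} = {g [^] n, h [^] n}"
      "carrier G \<inter> {g [^] n, h [^] n} = {g [^] n, h [^] n}"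
      using \<open>{g [^] n, h [^] n} \<subseteq> carrier ?H\<close> carrier_subgroup_generated_subset[of A] by blast+
    ultimately show ?thesis
      by (simp add: subgroup_generated_def[of ?H] subgroup_generated_def[of G "{_, _}"])
        (simp add: subgroup_generated_def)
  qed
  show ?thesis
    using assms(1)[unfolded law_power_alternative_def pow_subgroup_generated, rule_format, OF assms(2,3)]
    unfolding power_alternative_def eq .
qed

end

context tree_action
begin

section \<open>Stabilisers of ends\<close>

lemma shifts_ray_one: "ray x \<Longrightarrow> shifts_ray x \<one> 0"
  unfolding shifts_ray_def by (intro exI[of _ 0]) (simp add: action_one ray_in)

lemma shifts_ray_mult:
  assumes x: "ray x" and g: "g \<in> carrier G" "shifts_ray x g k" and h: "h \<in> carrier G" "shifts_ray x h m"
  shows "shifts_ray x (g \<otimes> h) (k + m)"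
proof -
  obtain a b where ab: "int b - int a = k" "\<And>i. \<phi> g (x (a + i)) = x (b + i)"
    using g(2) unfolding shifts_ray_def by blast
  obtain c d where cd: "int d - int c = m" "\<And>i. \<phi> h (x (c + i)) = x (d + i)"
    using h(2) unfolding shifts_ray_def by blast
  \<comment> \<open>The window is moved far enough along the ray for the image under
    \<open>h\<close> to lie where the shift by \<open>g\<close> is known.\<close>
  have "\<phi> (g \<otimes> h) (x (c + a + i)) = x (b + d + i)" for i
    using composition_rule[OF ray_in[OF x] g(1) h(1)] cd(2)[of "a + i"] ab(2)[of "d + i"]
    by (simp add: add.assoc add.left_commute)
  moreover have "int (b + d) - int (c + a) = k + m" using ab(1) cd(1) by simp
  ultimately show ?thesis unfolding shifts_ray_def by blast
qed

lemma shifts_ray_inv: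
  assumes x: "ray x" and g: "g \<in> carrier G" "shifts_ray x g k"
  shows "shifts_ray x (inv g) (- k)"
proof -
  obtain a b where ab: "int b - int a = k" "\<And>i. \<phi> g (x (a + i)) = x (b + i)"
    using g(2) unfolding shifts_ray_def by blast
  have "\<phi> (inv g) (x (b + i)) = x (a + i)" for i
    using inv_action(1)[OF g(1) ray_in[OF x], of "a + i"] ab(2)[of i] by simp
  moreover have "int a - int b = - k" using ab(1) by simp
  ultimately show ?thesis unfolding shifts_ray_def by blast
qed

lemma shifts_ray_pow:
  assumes x: "ray x" and g: "g \<in> carrier G" "shifts_ray x g k"
  shows "shifts_ray x (g [^] (n::nat)) (int n * k)"
proof -
  interpret group G by (rule is_group)
  show ?thesis
  proof (induction n)
    case 0
    show ?case using shifts_ray_one[OF x] by simp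
  next
    case (Suc n)
    then show ?case
      using shifts_ray_mult[OF x nat_pow_closed[OF g(1)] Suc g] by (simp add: algebra_simps)
  qed
qed

lemma shifts_ray_int_pow:
  assumes x: "ray x" and g: "g \<in> carrier G" "shifts_ray x g k"
  shows "shifts_ray x (g [^] (q::int)) (q * k)"
proof -
  interpret group G by (rule is_group)
  show ?thesis
  proof (cases q rule: int_cases2)
    case (nonneg n)
    then show ?thesis using shifts_ray_pow[OF x g, of n] by (simp add: int_pow_int)
  next
    case (nonpos n)
    then show ?thesis
      using shifts_ray_inv[OF x _ shifts_ray_pow[OF x g, of n]] g(1) by (simp add: int_pow_neg_int)
  qed
qed

text \<open>
  The elements shifting a ray form the stabiliser of its end. The shift amount is a homomorphism to
  the integers whose kernel, the union of the pointwise stabilisers of the tails, is itself the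
  pointwise stabiliser of a finite segment by the stabilisation property.
\<close>

lemma end_stabiliser:
  assumes stab: "stabilisation_property G V E \<phi>" and x: "ray x"
  obtains C z where "C \<in> vertex_stabiliser_intersections G V \<phi>" "z \<in> carrier G"
    "C \<lhd> subgroup_generated G (insert z C)"
    "\<And>g k. g \<in> carrier G \<Longrightarrow> shifts_ray x g k \<Longrightarrow> g \<in> carrier (subgroup_generated G (insert z C))"
proof -
  interpret group G by (rule is_group)
  obtain N where N: "\<And>n g. n \<ge> N \<Longrightarrow> g \<in> carrier G \<Longrightarrow> \<forall>i\<ge>n. \<phi> g (x i) = x i \<Longrightarrow> \<forall>i\<ge>N. \<phi> g (x i) = x i"
    using stabiliser_tails_stabilise[OF stab x] by blast
  obtain N' where N': "\<And>g. g \<in> carrier G \<Longrightarrow> \<forall>i\<le>N'. \<phi> g (x (N + i)) = x (N + i) \<Longrightarrow> \<forall>i. \<phi> g (x (N + i)) = x (N + i)"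
    using stabiliser_segments_stabilise[OF stab ray_shift[OF x, of N]] by blast
  \<comment> \<open>The pointwise stabiliser of the tail from \<open>N\<close> on; by the choice of
    \<open>N'\<close> it is also that of the first \<open>N' + 1\<close> vertices of this tail, a
    finite intersection of vertex stabilisers.\<close>
  define C where "C = {g \<in> carrier G. \<forall>i. \<phi> g (x (N + i)) = x (N + i)}"
  have CG: "C \<subseteq> carrier G" by (auto simp: C_def)
  have C0: "shifts_ray x g 0" if "g \<in> C" for g
    using that unfolding C_def shifts_ray_def by (intro exI[of _ N]) auto
  have C1: "g \<in> C" if g: "g \<in> carrier G" "shifts_ray x g 0" for g
  proof -
    \<comment> \<open>Shift amount zero makes the two offsets equal, so \<open>g\<close> fixes a
      tail pointwise.\<close>
    obtain a where a: "\<And>i. \<phi> g (x (a + i)) = x (a + i)"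
      using g(2) unfolding shifts_ray_def by auto
    have "\<forall>i\<ge>max N a. \<phi> g (x i) = x i" using a le_Suc_ex by (metis max.boundedE)
    then have "\<forall>i\<ge>N. \<phi> g (x i) = x i" using N[of "max N a" g] g(1) by simp
    then show ?thesis using g(1) by (simp add: C_def)
  qed
  have C_stab: "C = (\<Inter>v\<in>(\<lambda>i. x (N + i)) ` {..N'}. stabilizer G \<phi> v)"
    using N' by (auto simp: C_def stabilizer_def)
  have Cv: "C \<in> vertex_stabiliser_intersections G V \<phi>"
    unfolding vertex_stabiliser_intersections_def mem_Collect_eq
    by (rule exI[of _ "(\<lambda>i. x (N + i)) ` {..N'}"]) (use C_stab ray_in[OF x] in auto)
  have Csub: "subgroup C G"
  proof (rule subgroupI)
    show "C \<noteq> {}" using C1[OF one_closed shifts_ray_one[OF x]] by blast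
    show "inv a \<in> C" if "a \<in> C" for a
      using shifts_ray_inv[OF x _ C0[OF that]] C1[of "inv a"] CG that by auto
    show "a \<otimes> b \<in> C" if "a \<in> C" "b \<in> C" for a b
      using shifts_ray_mult[OF x _ C0[OF that(1)] _ C0[OF that(2)]] C1[of "a \<otimes> b"] CG that by auto
  qed (rule CG)
  define m where "m = (LEAST n. n > 0 \<and> (\<exists>g\<in>carrier G. shifts_ray x g (int n)))"
  have m_le: "m \<le> n" if "n > 0" "g \<in> carrier G" "shifts_ray x g (int n)" for n g
    unfolding m_def using that by (intro Least_le) blast
  \<comment> \<open>\<open>mz\<close> generates the group of all shift amounts: it is the least
    positive one, or zero with neutral \<open>z\<close> if only zero occurs.\<close>
  obtain z mz where z: "z \<in> carrier G" "shifts_ray x z mz"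
    and gen: "\<And>g k. g \<in> carrier G \<Longrightarrow> shifts_ray x g k \<Longrightarrow> mz dvd k"
  proof (cases "\<exists>n::nat. n > 0 \<and> (\<exists>g\<in>carrier G. shifts_ray x g (int n))")
    case True
    then have m: "m > 0" "\<exists>g\<in>carrier G. shifts_ray x g (int m)"
      using LeastI_ex[OF True] by (auto simp: m_def)
    then obtain z where z: "z \<in> carrier G" "shifts_ray x z (int m)" by blast
    have dvd: "int m dvd k" if g: "g \<in> carrier G" "shifts_ray x g k" for g k
    proof (rule ccontr)
      assume "\<not> int m dvd k"
      then have "k mod int m \<noteq> 0" by (simp add: dvd_eq_mod_eq_0)
      moreover have "k mod int m \<ge> 0" using m(1) by simp
      ultimately have pos: "k mod int m > 0" by linarith
      \<comment> \<open>Division with remainder: a shift amount not divisible by \<open>m\<close>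
        would leave a smaller positive one.\<close>
      have "shifts_ray x (g \<otimes> z [^] (- (k div int m))) (k + - (k div int m) * int m)"
        using shifts_ray_mult[OF x g _ shifts_ray_int_pow[OF x z]] z(1) by blast
      then have "shifts_ray x (g \<otimes> z [^] (- (k div int m))) (int (nat (k mod int m)))"
        using pos by (simp add: minus_div_mult_eq_mod)
      then have "m \<le> nat (k mod int m)"
        using m_le[of "nat (k mod int m)" "g \<otimes> z [^] (- (k div int m))"] g(1) z(1) pos by simp
      then show False using pos m(1) pos_mod_bound[of "int m" k] by linarith
    qed
    show thesis by (rule that[OF z dvd])
  next
    case False
    have "k = 0" if g: "g \<in> carrier G" "shifts_ray x g k" for g k
    proof (rule ccontr)
      assume "k \<noteq> 0"
      then consider "k > 0" | "- k > 0" by linarith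
      then show False
      proof cases
        case 1
        then obtain n where "n > 0" "k = int n" using zero_less_imp_eq_int by blast
        then show False using False g by blast
      next
        case 2
        then obtain n where n: "n > 0" "- k = int n" using zero_less_imp_eq_int by blast
        then have "shifts_ray x (inv g) (int n)" using shifts_ray_inv[OF x g] by simp
        then show False using False n(1) inv_closed[OF g(1)] by blast
      qed
    qed
    then have dvd: "0 dvd k" if "g \<in> carrier G" "shifts_ray x g k" for g k using that by simp
    show thesis by (rule that[OF one_closed shifts_ray_one[OF x] dvd])
  qed
  let ?H = "subgroup_generated G (insert z C)"
  have sub: "insert z C \<subseteq> carrier G" using z CG by auto
  interpret H: group ?H by simp
  have inH: "g \<in> carrier ?H" if g: "g \<in> carrier G" "shifts_ray x g k" for g k
  proof -
    obtain q where q: "k = mz * q" using gen[OF g] by blast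
    have "shifts_ray x (g \<otimes> z [^] (- q)) (k + - q * mz)"
      using shifts_ray_mult[OF x g _ shifts_ray_int_pow[OF x z]] z(1) by blast
    then have "g \<otimes> z [^] (- q) \<in> C" using C1[of "g \<otimes> z [^] (- q)"] g(1) z(1) q by simp
    then have c: "g \<otimes> z [^] (- q) \<in> carrier ?H" and zH: "z \<in> carrier ?H"
      using subgroup_generated_subset_carrier_subset[OF sub] by auto
    have "z [^] q \<in> carrier ?H"
      using H.int_pow_closed[OF zH, of q] int_pow_subgroup_generated[OF zH, of q] by simp
    then have "(g \<otimes> z [^] (- q)) \<otimes> z [^] q \<in> carrier ?H" using H.m_closed[OF c] by simp
    moreover have "(g \<otimes> z [^] (- q)) \<otimes> z [^] q = g"
      using g(1) z(1) by (simp add: m_assoc int_pow_neg)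
    ultimately show ?thesis by simp
  qed
  \<comment> \<open>This gives normality: conjugating an element of \<open>C\<close> by one that
    shifts the ray gives shift amount zero again.\<close>
  have shiftH: "\<exists>k. shifts_ray x g k" if "g \<in> carrier ?H" for g
  proof -
    have "g \<in> generate G (insert z C)"
      using that sub by (simp add: carrier_subgroup_generated Int_absorb1)
    then show ?thesis
    proof (induction rule: generate.induct)
      case one
      then show ?case using shifts_ray_one[OF x] by blast
    next
      case (incl h)
      then show ?case using z C0 by auto
    next
      case (inv h)
      then have "h \<in> carrier G" "\<exists>k. shifts_ray x h k" using z C0 sub by auto
      then show ?case using shifts_ray_inv[OF x] by blast
    next
      case (eng h1 h2)
      then show ?case using shifts_ray_mult[OF x] generate_in_carrier[OF sub] by blast
    qed
  qed
  have "C \<lhd> ?H"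
    unfolding H.normal_inv_iff
  proof (intro conjI ballI)
    show "subgroup C ?H" by (rule subgroup_of_subgroup_generated[OF _ Csub]) blast
    fix g c assume g: "g \<in> carrier ?H" and c: "c \<in> C"
    obtain k where k: "shifts_ray x g k" using shiftH[OF g] by blast
    have gG: "g \<in> carrier G" and cG: "c \<in> carrier G"
      using g c CG carrier_subgroup_generated_subset by blast+
    have "shifts_ray x (g \<otimes> c \<otimes> inv g) (k + 0 + - k)"
      using shifts_ray_mult[OF x _ shifts_ray_mult[OF x gG k cG C0[OF c]] _ shifts_ray_inv[OF x gG k]] gG cG
      by blast
    then have "g \<otimes> c \<otimes> inv g \<in> C" using C1[of "g \<otimes> c \<otimes> inv g"] gG cG by simp
    then show "g \<otimes>\<^bsub>?H\<^esub> c \<otimes>\<^bsub>?H\<^esub> inv\<^bsub>?H\<^esub> g \<in> C" using g by simp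
  qed
  then show thesis using that[OF Cv z(1)] inH by blast
qed

end

section \<open>The alternative by type of the two elements\<close>

locale law_tree_action = tree_action G V E \<phi>
  for G (structure) and V :: "'v set" and E :: "'v set set" and \<phi> +
  fixes r :: nat and w :: "nat letter list"
  assumes stabilisation: "stabilisation_property G V E \<phi>"
    and stabiliser_extensions: "\<And>z C. z \<in> carrier G \<Longrightarrow> C \<in> vertex_stabiliser_intersections G V \<phi> \<Longrightarrow>
           C \<lhd> subgroup_generated G (insert z C) \<Longrightarrow>
           law_power_alternative r w (subgroup_generated G (insert z C))"
begin

lemma power_alternative_common_end:
  assumes "g \<in> carrier G" "h \<in> carrier G" "ray x" "shifts_ray x g k" "shifts_ray x h m"
  shows "power_alternative r w G g h"
proof -
  interpret group G by (rule is_group)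
  obtain C z where C: "C \<in> vertex_stabiliser_intersections G V \<phi>" "z \<in> carrier G"
    "C \<lhd> subgroup_generated G (insert z C)"
    and H: "\<And>g k. g \<in> carrier G \<Longrightarrow> shifts_ray x g k \<Longrightarrow> g \<in> carrier (subgroup_generated G (insert z C))"
    using end_stabiliser[OF stabilisation assms(3)] by blast
  show ?thesis
    using power_alternative_subgroup[OF stabiliser_extensions[OF C(2,1,3)]] H assms by blast
qed

text \<open>The hypothesis on extensions is used with \<open>C\<close> a single vertex stabiliser
  and \<open>z\<close> neutral; \<open>C\<close> is normal in itself.\<close>

lemma power_alternative_common_vertex:
  assumes "g \<in> carrier G" "h \<in> carrier G" "v \<in> V" "\<phi> g v = v" "\<phi> h v = v"
  shows "power_alternative r w G g h"
proof -
  interpret group G by (rule is_group)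
  let ?C = "stabilizer G \<phi> v"
  have gh: "g \<in> ?C" "h \<in> ?C" using assms by (auto simp: stabilizer_def)
  have sub: "subgroup ?C G" using stabilizer_subgroup[OF assms(3)] .
  have H: "subgroup_generated G (insert \<one> ?C) = subgroup_generated G ?C"
    using subgroup.one_closed[OF sub] by (simp add: insert_absorb)
  interpret H: group "subgroup_generated G ?C" by simp
  have car: "carrier (subgroup_generated G ?C) = ?C"
    using subgroup.carrier_subgroup_generated_subgroup[OF sub] .
  have "?C \<lhd> subgroup_generated G ?C"
    unfolding H.normal_inv_iff using H.subgroup_self H.inv_closed H.m_closed car by metis
  moreover have "?C \<in> vertex_stabiliser_intersections G V \<phi>"
    unfolding vertex_stabiliser_intersections_def using assms(3) by (auto intro!: exI[of _ "{v}"])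
  ultimately have "law_power_alternative r w (subgroup_generated G ?C)"
    using stabiliser_extensions[of \<one> ?C] by (simp add: H)
  then show ?thesis
    using power_alternative_subgroup[of r w ?C g h] gh by (simp add: car)
qed

lemma power_alternative_ping_pong:
  assumes gh: "g \<in> carrier G" "h \<in> carrier G" and "M \<ge> 1"
    and XY: "X \<subseteq> V" "Y \<subseteq> V" "X \<inter> Y = {}" "Y \<noteq> {}"
    and A: "\<And>k::int. k \<noteq> 0 \<Longrightarrow> \<phi> (g [^] (int M * k)) ` Y \<subseteq> X"
    and B: "\<And>k::int. k \<noteq> 0 \<Longrightarrow> \<phi> (h [^] (int M * k)) ` X \<subseteq> Y"
  shows "power_alternative r w G g h"
proof -
  interpret group G by (rule is_group)
  have "f [^] (int M * k) = (f [^] M) [^] k" if "f \<in> carrier G" for f and k :: int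
    using int_pow_pow[OF that, of "int M" k] by (simp add: int_pow_int)
  then have "subgroup_generated G {g [^] M, h [^] M} \<cong> free_group_rank 2"
    using ping_pong_free[of "g [^] M" "h [^] M" X Y] gh XY A B by simp
  then show ?thesis unfolding power_alternative_def using assms(3) by blast
qed

text \<open>Membership in \<open>P\<close> or \<open>Q\<close> refers to arbitrary nonzero
  exponents. This lets disjointness of the two sets control all powers at once.\<close>

lemma power_alternative_elliptic:
  assumes g: "g \<in> carrier G" "p0 \<in> V" "\<phi> g p0 = p0" and h: "h \<in> carrier G" "q0 \<in> V" "\<phi> h q0 = q0"
  shows "power_alternative r w G g h"
proof -
  interpret group G by (rule is_group)
  define P where "P = {v \<in> V. \<exists>k::int. k \<noteq> 0 \<and> \<phi> (g [^] k) v = v}"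
  define Q where "Q = {v \<in> V. \<exists>k::int. k \<noteq> 0 \<and> \<phi> (h [^] k) v = v}"
  have ne: "p0 \<in> P" "q0 \<in> Q" using g h by (auto simp: P_def Q_def intro!: exI[of _ 1])
  have common_power: "\<exists>M::nat. M \<ge> 1 \<and> (\<forall>k::int. \<phi> (g [^] (int M * k)) p = p) \<and>
      (\<forall>k::int. \<phi> (h [^] (int M * k)) q = q)" if pq: "p \<in> P" "q \<in> Q" for p q
  proof -
    obtain i where i: "i \<noteq> 0" "\<phi> (g [^] (i::int)) p = p" using pq by (auto simp: P_def)
    obtain j where j: "j \<noteq> 0" "\<phi> (h [^] (j::int)) q = q" using pq by (auto simp: Q_def)
    \<comment> \<open>The absolute value of \<open>i * j\<close> is a positive multiple of both
      exponents, so it serves \<open>p\<close> and \<open>q\<close> together.\<close>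
    have e: "int (nat \<bar>i * j\<bar>) = i * j * sgn (i * j)" using abs_sgn[of "i * j"] by simp
    have M: "int (nat \<bar>i * j\<bar>) * k = i * (sgn (i * j) * j * k)"
      "int (nat \<bar>i * j\<bar>) * k = j * (sgn (i * j) * i * k)" for k
      unfolding e by (simp_all only: ac_simps)
    have "\<phi> (g [^] (int (nat \<bar>i * j\<bar>) * k)) p = p" for k
      unfolding M(1) by (rule fixed_int_pow_mult) (use g pq i in \<open>auto simp: P_def\<close>)
    moreover have "\<phi> (h [^] (int (nat \<bar>i * j\<bar>) * k)) q = q" for k
      unfolding M(2) by (rule fixed_int_pow_mult) (use h pq j in \<open>auto simp: Q_def\<close>)
    moreover have "nat \<bar>i * j\<bar> \<ge> 1" using i j by (simp add: Suc_le_eq)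
    ultimately show ?thesis by blast
  qed
  show ?thesis
  proof (cases "P \<inter> Q = {}")
    case False
    then obtain v where v: "v \<in> P" "v \<in> Q" by blast
    then obtain M where M: "M \<ge> (1::nat)" "\<phi> (g [^] (int M * 1)) v = v" "\<phi> (h [^] (int M * 1)) v = v"
      using common_power by meson
    then have "power_alternative r w G (g [^] M) (h [^] M)"
      using v g h by (intro power_alternative_common_vertex[of _ _ v]) (auto simp: P_def int_pow_int)
    then show ?thesis using power_alternative_pow g h M by blast
  next
    case True
    \<comment> \<open>The bridge is obtained as a pair of vertices of \<open>P\<close> and
      \<open>Q\<close> at least distance.\<close>
    obtain pq where pq: "pq \<in> P \<times> Q"
      and least: "\<And>ab. ab \<in> P \<times> Q \<Longrightarrow> nat (gdist (fst pq) (snd pq)) \<le> nat (gdist (fst ab) (snd ab))"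
      using ex_has_least_nat[of "\<lambda>ab. ab \<in> P \<times> Q" "(p0, q0)" "\<lambda>ab. nat (gdist (fst ab) (snd ab))"] ne
      by auto
    obtain p q where eq: "pq = (p, q)" by fastforce
    have p: "p \<in> P" "p \<in> V" and q: "q \<in> Q" "q \<in> V" using pq by (auto simp: eq P_def Q_def)
    have min: "gdist p q \<le> gdist a b" if "a \<in> P" "b \<in> Q" for a b
      using least[of "(a, b)"] that by (simp add: eq nat_le_iff)
    have "p \<noteq> q" using True p q by blast
    obtain M where M: "M \<ge> (1::nat)" "\<And>k::int. \<phi> (g [^] (int M * k)) p = p"
      "\<And>k::int. \<phi> (h [^] (int M * k)) q = q" using common_power[OF p(1) q(1)] by blast
    \<comment> \<open>The neighbour of \<open>p\<close> on the bridge is closer to \<open>q\<close>,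
      so by minimality it lies outside \<open>P\<close> and every nonzero power of \<open>g\<close>
      moves it.\<close>
    have nP: "\<phi> (g [^] j) s \<noteq> s" if "s \<in> V" "gdist p s = 1" "btw p s q" "j \<noteq> 0" for s and j :: int
    proof -
      have "s \<notin> P" using min[OF _ q(1), of s] that by (auto simp: btw_def)
      then show ?thesis using that by (auto simp: P_def)
    qed
    have nQ: "\<phi> (h [^] j) s \<noteq> s" if "s \<in> V" "gdist q s = 1" "btw q s p" "j \<noteq> 0" for s and j :: int
    proof -
      have "s \<notin> Q" using min[OF p(1), of s] that by (auto simp: btw_def gdist_commute)
      then show ?thesis using that by (auto simp: Q_def)
    qed
    define X where "X = {v \<in> V. btw v p q}"
    define Y where "Y = {v \<in> V. btw v q p}"
    show ?thesis
    proof (rule power_alternative_ping_pong[OF g(1) h(1) M(1), of X Y])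
      have "gdist p q > 0" using gdist_eq_0[OF p(2) q(2)] \<open>p \<noteq> q\<close> by (simp add: less_le)
      then show "X \<inter> Y = {}" by (auto simp: X_def Y_def btw_def gdist_commute)
      show "Y \<noteq> {}" using q by (auto simp: Y_def btw_def)
      fix k :: int assume "k \<noteq> 0"
      then have Mk: "int M * k \<noteq> 0" using M(1) by simp
      show "\<phi> (g [^] (int M * k)) ` Y \<subseteq> X"
      proof clarify
        fix v assume v: "v \<in> Y"
        have "btw (\<phi> (g [^] (int M * k)) v) p q"
          by (rule elliptic_ping_pong[OF _ M(2) p(2) q(2) _ \<open>p \<noteq> q\<close> nP[OF _ _ _ Mk]])
            (use v g in \<open>auto simp: Y_def\<close>)
        then show "\<phi> (g [^] (int M * k)) v \<in> X" using v g action_closed by (simp add: X_def Y_def)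
      qed
      show "\<phi> (h [^] (int M * k)) ` X \<subseteq> Y"
      proof clarify
        fix v assume v: "v \<in> X"
        have "btw (\<phi> (h [^] (int M * k)) v) q p"
          by (rule elliptic_ping_pong[OF _ M(3) q(2) p(2) _ \<open>p \<noteq> q\<close>[symmetric] nQ[OF _ _ _ Mk]])
            (use v h in \<open>auto simp: X_def\<close>)
        then show "\<phi> (h [^] (int M * k)) v \<in> Y" using v h action_closed by (simp add: X_def Y_def)
      qed
    qed (auto simp: X_def Y_def)
  qed
qed

text \<open>A power of \<open>g\<close> fixing \<open>u K\<close> fixes the segment from
  \<open>u 0\<close> to \<open>u K\<close> pointwise, and for \<open>K\<close> beyond the
  stabilisation index the whole ray. This index belongs to the ray, not to the power.\<close>

lemma no_power_fixes_far_vertex: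
  assumes g: "g \<in> carrier G" "\<phi> g (u 0) = u 0" and u: "ray u"
    and nofix: "\<And>k::int. k \<noteq> 0 \<Longrightarrow> \<not> (\<forall>i. \<phi> (g [^] k) (u i) = u i)"
  shows "\<exists>N. \<forall>K\<ge>N. \<forall>k::int. k \<noteq> 0 \<longrightarrow> \<phi> (g [^] k) (u K) \<noteq> u K"
proof -
  interpret group G by (rule is_group)
  obtain N where N: "\<And>f. f \<in> carrier G \<Longrightarrow> \<forall>i\<le>N. \<phi> f (u i) = u i \<Longrightarrow> \<forall>i. \<phi> f (u i) = u i"
    using stabiliser_segments_stabilise[OF stabilisation u] by blast
  have "\<phi> (g [^] k) (u K) \<noteq> u K" if K: "K \<ge> N" and k: "k \<noteq> 0" for K and k :: int
  proof
    assume fx: "\<phi> (g [^] k) (u K) = u K"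
    have "\<phi> (g [^] k) (u i) = u i" if "i \<le> N" for i
      by (rule rays_agree_below[OF ray_action[OF _ u] u, where K = K])
        (use fx fixed_int_pow[OF g(1) ray_in[OF u] g(2)] that K g in auto)
    then show False using N[of "g [^] k"] nofix[OF k] g(1) by auto
  qed
  then show ?thesis by blast
qed

text \<open>Replacing \<open>k\<close> by its absolute value gives a positive exponent
  \<open>n\<close>. Then \<open>g [^] n\<close> has shift amount zero and \<open>h [^] n\<close>
  shifts the ray too, so both fix its end.\<close>

lemma power_alternative_fixed_ray:
  fixes k :: int
  assumes g: "g \<in> carrier G" and h: "h \<in> carrier G" and u: "ray u" "\<exists>m. shifts_ray u h m"
    and fx: "k \<noteq> 0" "\<And>i. \<phi> (g [^] k) (u i) = u i"
  shows "power_alternative r w G g h"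
proof -
  interpret group G by (rule is_group)
  define n where "n = nat \<bar>k\<bar>"
  have n1: "n \<ge> 1" using fx(1) by (simp add: n_def Suc_le_eq)
  have "int n = \<bar>k\<bar>" by (simp add: n_def)
  then have nk: "int n = k * sgn k" using abs_sgn[of k] by simp
  have "\<phi> (g [^] n) (u i) = u i" for i
    using fixed_int_pow_mult[OF g ray_in[OF u(1)] fx(2), where k = "sgn k"] int_pow_int[of G g n] by (simp add: nk)
  then have "shifts_ray u (g [^] n) 0" unfolding shifts_ray_def by (intro exI[of _ 0]) simp
  moreover obtain m where "shifts_ray u (h [^] n) (int n * m)"
    using u(2) shifts_ray_pow[OF u(1) h] by blast
  ultimately have "power_alternative r w G (g [^] n) (h [^] n)"
    using power_alternative_common_end[OF _ _ u(1)] g h by simp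
  then show ?thesis using power_alternative_pow[OF g h n1] by blast
qed

text \<open>A power of \<open>g\<close> fixes \<open>p\<close> and carries the vertices beyond
  \<open>a\<close> to those beyond the image of \<open>a\<close>, at the same distance from
  \<open>p\<close>. It moves the cone off itself once it sends \<open>u K\<close> and
  \<open>u' K\<close> to neither of these two. Ping-pong is then played with the cone and its
  complement.\<close>

lemma power_alternative_mixed:
  assumes g: "g \<in> carrier G" "p \<in> V" "\<phi> g p = p"
    and h: "h \<in> carrier G" "\<And>v. v \<in> V \<Longrightarrow> \<phi> h v \<noteq> v"
  shows "power_alternative r w G g h"
proof -
  interpret group G by (rule is_group)
  obtain u u' where u: "ray u" "u 0 = p" "\<exists>k. shifts_ray u h k"
    and u': "ray u'" "u' 0 = p" "\<exists>k. shifts_ray u' h k"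
    and dyn: "\<And>K. \<exists>M::nat. M \<ge> 1 \<and> (\<forall>k::int. \<bar>k\<bar> \<ge> int M \<longrightarrow> \<phi> (h [^] k) ` (V - cone u u' K) \<subseteq> cone u u' K)"
    using hyperbolic_rays[OF h g(2)] by metis
  show ?thesis
  proof (cases "\<exists>k::int. k \<noteq> 0 \<and> ((\<forall>i. \<phi> (g [^] k) (u i) = u i) \<or> (\<forall>i. \<phi> (g [^] k) (u' i) = u' i))")
    case True
    then show ?thesis
      using power_alternative_fixed_ray[OF g(1) h(1) u(1,3)] power_alternative_fixed_ray[OF g(1) h(1) u'(1,3)]
      by blast
  next
    case False
    obtain N1 where N1: "\<And>K k. K \<ge> N1 \<Longrightarrow> k \<noteq> 0 \<Longrightarrow> \<phi> (g [^] (k::int)) (u K) \<noteq> u K"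
      using no_power_fixes_far_vertex[OF g(1) _ u(1)] False g(3) u(2) by metis
    obtain N2 where N2: "\<And>K k. K \<ge> N2 \<Longrightarrow> k \<noteq> 0 \<Longrightarrow> \<phi> (g [^] (k::int)) (u' K) \<noteq> u' K"
      using no_power_fixes_far_vertex[OF g(1) _ u'(1)] False g(3) u'(2) by metis
    define K where "K = max N1 N2"
    let ?s = "u K" and ?t = "u' K"
    have s: "?s \<in> V" "\<And>k. k \<noteq> 0 \<Longrightarrow> \<phi> (g [^] (k::int)) ?s \<noteq> ?s"
      and t: "?t \<in> V" "\<And>k. k \<noteq> 0 \<Longrightarrow> \<phi> (g [^] (k::int)) ?t \<noteq> ?t"
      using N1[of K] N2[of K] ray_in[OF u(1)] ray_in[OF u'(1)] by (auto simp: K_def)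
    have p: "\<phi> (g [^] k) p = p" for k :: int using fixed_int_pow[OF g] .
    \<comment> \<open>At most one power of \<open>g\<close> exchanges the two branches; a suitable multiple avoids it.\<close>
    obtain m :: nat where m: "m \<ge> 1" "\<And>k. k \<noteq> 0 \<Longrightarrow> \<phi> (g [^] (int m * k)) ?s \<noteq> ?t"
    proof (cases "\<exists>k0::int. k0 \<noteq> 0 \<and> \<phi> (g [^] k0) ?s = ?t")
      case True
      then obtain k0 :: int where k0: "k0 \<noteq> 0" "\<phi> (g [^] k0) ?s = ?t" by blast
      have "\<phi> (g [^] (int (nat (2 * \<bar>k0\<bar>)) * k)) ?s \<noteq> ?t" if "k \<noteq> 0" for k
      proof
        let ?j = "int (nat (2 * \<bar>k0\<bar>)) * k"
        assume j: "\<phi> (g [^] ?j) ?s = ?t"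
        \<comment> \<open>Otherwise this power fixes \<open>?s\<close>, so its exponent vanishes and
          \<open>k0\<close> equals twice its own absolute value times \<open>k\<close>, impossible
          for nonzero \<open>k0\<close> and \<open>k\<close>.\<close>
        have "\<phi> (g [^] (- k0 + ?j)) ?s = \<phi> (g [^] (- k0)) ?t"
          using action_int_pow_add[OF g(1) s(1), of "- k0" ?j] j by simp
        also have "\<dots> = ?s"
          using action_int_pow_add[OF g(1) s(1), of "- k0" k0] k0(2) s(1) by (simp add: action_one)
        finally have "- k0 + ?j = 0" using s(2) by blast
        then have e: "k0 = 2 * \<bar>k0\<bar> * k" by simp
        have "\<bar>k0\<bar> = 2 * \<bar>k0\<bar> * \<bar>k\<bar>"
          using arg_cong[OF e, of abs] by (simp only: abs_mult abs_abs abs_numeral)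
        moreover have "\<bar>k0\<bar> * 1 \<le> \<bar>k0\<bar> * \<bar>k\<bar>" using that by (intro mult_left_mono) auto
        ultimately show False using k0(1) by linarith
      qed
      then show thesis using that[of "nat (2 * \<bar>k0\<bar>)"] k0(1) by (simp add: Suc_le_eq)
    next
      case False
      then show thesis using that[of 1] by auto
    qed
    have m': "\<phi> (g [^] (int m * k)) ?t \<noteq> ?s" if "k \<noteq> 0" for k
    proof
      assume "\<phi> (g [^] (int m * k)) ?t = ?s"
      then have "\<phi> (g [^] (int m * (- k))) ?s = \<phi> (g [^] (int m * (- k) + int m * k)) ?t"
        using action_int_pow_add[OF g(1) t(1), of "int m * (- k)" "int m * k"] by simp
      also have "\<dots> = ?t" using t(1) by (simp add: action_one)
      finally show False using m(2)[of "- k"] that by simp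
    qed
    obtain M where M: "M \<ge> (1::nat)"
      "\<And>k::int. \<bar>k\<bar> \<ge> int M \<Longrightarrow> \<phi> (h [^] k) ` (V - cone u u' K) \<subseteq> cone u u' K"
      using dyn[of K] by blast
    have dist: "gdist p ?s = int K" "gdist p ?t = int K"
      using ray_gdist[OF u(1), of 0 K] ray_gdist[OF u'(1), of 0 K] u(2) u'(2) by auto
    show ?thesis
    \<comment> \<open>The factor \<open>m\<close> keeps powers of \<open>g\<close> from exchanging
      the branches, and the factor \<open>M\<close> makes the exponents of \<open>h\<close> large
      enough.\<close>
    proof (rule power_alternative_ping_pong[OF g(1) h(1), of "m * M" "V - cone u u' K" "cone u u' K"])
      show "m * M \<ge> 1" using m(1) M(1) by simp
      show "cone u u' K \<noteq> {}" using s(1) by (auto simp: cone_def btw_def)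
      fix k :: int assume k: "k \<noteq> 0"
      have "int (m * M) * 1 \<le> int (m * M) * \<bar>k\<bar>" using k by (intro mult_left_mono) auto
      moreover have "int M * 1 \<le> int M * int m" using m(1) by (intro mult_left_mono) auto
      ultimately have "int M \<le> \<bar>int (m * M) * k\<bar>" by (simp add: abs_mult mult.commute)
      then show "\<phi> (h [^] (int (m * M) * k)) ` (V - cone u u' K) \<subseteq> cone u u' K" using M(2) by blast
      define j where "j = int M * k"
      have j: "j \<noteq> 0" "int (m * M) * k = int m * j" using k M(1) by (auto simp: j_def)
      let ?f = "g [^] (int m * j)"
      have f: "?f \<in> carrier G" using g(1) by simp
      have mj: "int m * j \<noteq> 0" using j(1) m(1) by simp
      show "\<phi> (g [^] (int (m * M) * k)) ` cone u u' K \<subseteq> V - cone u u' K"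
        unfolding j(2)
      proof clarify
        fix y assume y: "y \<in> cone u u' K"
        then have yV: "y \<in> V" by (simp add: cone_def)
        then have fy: "\<phi> ?f y \<in> V" using action_closed[OF f] by blast
        obtain a where a: "a \<in> {?s, ?t}" "btw p a y" using y u(2) by (auto simp: cone_def)
        have aV: "a \<in> V" and da: "gdist p a = int K" using a(1) s(1) t(1) dist by auto
        have fa: "btw p (\<phi> ?f a) (\<phi> ?f y)" "gdist p (\<phi> ?f a) = int K"
          using btw_action[OF f g(2) aV yV] gdist_action[OF f g(2) aV] p a(2) da by auto
        have "\<phi> ?f y \<notin> cone u u' K"
        proof
          assume "\<phi> ?f y \<in> cone u u' K"
          then obtain c where c: "c \<in> {?s, ?t}" "btw p c (\<phi> ?f y)" using u(2) by (auto simp: cone_def)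
          then have "c \<in> V" "gdist p c = int K" using s(1) t(1) dist by auto
          then have "\<phi> ?f a = c"
            using btw_unique[OF g(2) action_closed[OF f aV] _ fy fa(1) c(2)] fa(2) by simp
          then show False using a(1) c(1) s(2)[OF mj] t(2)[OF mj] m(2)[OF j(1)] m'[OF j(1)] by auto
        qed
        then show "\<phi> ?f y \<in> V - cone u u' K" using fy by blast
      qed
    qed (auto simp: cone_def)
  qed
qed

text \<open>All four rays start at \<open>p\<close>, so a common end of the chosen rays means
  equality of two of them. Otherwise the cones at a large common depth are disjoint, and each
  contains the image of the other under high powers.\<close>

lemma power_alternative_hyperbolic:
  assumes g: "g \<in> carrier G" "\<And>v. v \<in> V \<Longrightarrow> \<phi> g v \<noteq> v"
    and h: "h \<in> carrier G" "\<And>v. v \<in> V \<Longrightarrow> \<phi> h v \<noteq> v"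
  shows "power_alternative r w G g h"
proof -
  interpret group G by (rule is_group)
  obtain p where p: "p \<in> V" using nonempty by blast
  obtain u u' where u: "ray u" "u 0 = p" "\<exists>k. shifts_ray u g k"
    and u': "ray u'" "u' 0 = p" "\<exists>k. shifts_ray u' g k"
    and dynu: "\<And>K. \<exists>M::nat. M \<ge> 1 \<and> (\<forall>k::int. \<bar>k\<bar> \<ge> int M \<longrightarrow> \<phi> (g [^] k) ` (V - cone u u' K) \<subseteq> cone u u' K)"
    using hyperbolic_rays[OF g p] by metis
  obtain t t' where t: "ray t" "t 0 = p" "\<exists>k. shifts_ray t h k"
    and t': "ray t'" "t' 0 = p" "\<exists>k. shifts_ray t' h k"
    and dynt: "\<And>K. \<exists>M::nat. M \<ge> 1 \<and> (\<forall>k::int. \<bar>k\<bar> \<ge> int M \<longrightarrow> \<phi> (h [^] k) ` (V - cone t t' K) \<subseteq> cone t t' K)"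
    using hyperbolic_rays[OF h p] by metis
  show ?thesis
  proof (cases "u = t \<or> u = t' \<or> u' = t \<or> u' = t'")
    case True
    then show ?thesis using power_alternative_common_end[OF g(1) h(1)] u u' t t' by metis
  next
    case False
    \<comment> \<open>Rays with a common origin agree below any common vertex at the same index, so
      once separated they stay separated.\<close>
    have diff: "\<exists>N. \<forall>K\<ge>N. a K \<noteq> b K" if "ray a" "ray b" "a 0 = b 0" "a \<noteq> b" for a b
    proof -
      obtain i where "a i \<noteq> b i" using \<open>a \<noteq> b\<close> by blast
      then have "\<forall>K\<ge>i. a K \<noteq> b K" using rays_agree_below[OF that(1-3)] by blast
      then show ?thesis by blast
    qed
    obtain N1 where N1: "\<And>K. K \<ge> N1 \<Longrightarrow> u K \<noteq> t K" using diff[OF u(1) t(1)] u t False by metis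
    obtain N2 where N2: "\<And>K. K \<ge> N2 \<Longrightarrow> u K \<noteq> t' K" using diff[OF u(1) t'(1)] u t' False by metis
    obtain N3 where N3: "\<And>K. K \<ge> N3 \<Longrightarrow> u' K \<noteq> t K" using diff[OF u'(1) t(1)] u' t False by metis
    obtain N4 where N4: "\<And>K. K \<ge> N4 \<Longrightarrow> u' K \<noteq> t' K" using diff[OF u'(1) t'(1)] u' t' False by metis
    define K where "K = N1 + N2 + N3 + N4"
    have neq: "u K \<noteq> t K" "u K \<noteq> t' K" "u' K \<noteq> t K" "u' K \<noteq> t' K"
      using N1[of K] N2[of K] N3[of K] N4[of K] by (auto simp: K_def)
    have disj: "cone u u' K \<inter> cone t t' K = {}"
    proof (rule ccontr)
      assume "cone u u' K \<inter> cone t t' K \<noteq> {}"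
      then obtain y a b where y: "y \<in> V" and a: "a \<in> {u K, u' K}" "btw p a y" and b: "b \<in> {t K, t' K}" "btw p b y"
        using u(2) t(2) by (auto simp: cone_def)
      have "a \<in> V" "b \<in> V" "gdist p a = int K" "gdist p b = int K"
        using a(1) b(1) ray_in[OF u(1)] ray_in[OF u'(1)] ray_in[OF t(1)] ray_in[OF t'(1)]
          ray_gdist[OF u(1), of 0 K] ray_gdist[OF u'(1), of 0 K] ray_gdist[OF t(1), of 0 K]
          ray_gdist[OF t'(1), of 0 K] u(2) u'(2) t(2) t'(2) by auto
      then have "a = b" using btw_unique[OF p _ _ y a(2) b(2)] by simp
      then show False using a(1) b(1) neq by auto
    qed
    obtain M1 where M1: "M1 \<ge> (1::nat)"
      "\<And>k::int. \<bar>k\<bar> \<ge> int M1 \<Longrightarrow> \<phi> (g [^] k) ` (V - cone u u' K) \<subseteq> cone u u' K"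
      using dynu[of K] by blast
    obtain M2 where M2: "M2 \<ge> (1::nat)"
      "\<And>k::int. \<bar>k\<bar> \<ge> int M2 \<Longrightarrow> \<phi> (h [^] k) ` (V - cone t t' K) \<subseteq> cone t t' K"
      using dynt[of K] by blast
    have coneV: "cone u u' K \<subseteq> V" "cone t t' K \<subseteq> V" by (auto simp: cone_def)
    show ?thesis
    proof (rule power_alternative_ping_pong[OF g(1) h(1), of "M1 + M2" "cone u u' K" "cone t t' K"])
      show "M1 + M2 \<ge> 1" using M1(1) by simp
      show "cone t t' K \<noteq> {}" using ray_in[OF t(1), of K] by (auto simp: cone_def btw_def)
      fix k :: int assume k: "k \<noteq> 0"
      have "int (M1 + M2) * 1 \<le> int (M1 + M2) * \<bar>k\<bar>" using k by (intro mult_left_mono) auto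
      then have "int M1 \<le> \<bar>int (M1 + M2) * k\<bar>" "int M2 \<le> \<bar>int (M1 + M2) * k\<bar>"
        by (auto simp: abs_mult)
      then show "\<phi> (g [^] (int (M1 + M2) * k)) ` cone t t' K \<subseteq> cone u u' K"
        "\<phi> (h [^] (int (M1 + M2) * k)) ` cone u u' K \<subseteq> cone t t' K"
        using M1(2) M2(2) disj coneV by blast+
    qed (use coneV disj in auto)
  qed
qed

lemma law_power_alternative: "law_power_alternative r w G"
  unfolding law_power_alternative_iff
proof (intro ballI)
  fix g h assume gh: "g \<in> carrier G" "h \<in> carrier G"
  consider p q where "p \<in> V" "\<phi> g p = p" "q \<in> V" "\<phi> h q = q"
    | p where "p \<in> V" "\<phi> g p = p" "\<And>v. v \<in> V \<Longrightarrow> \<phi> h v \<noteq> v"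
    | p where "p \<in> V" "\<phi> h p = p" "\<And>v. v \<in> V \<Longrightarrow> \<phi> g v \<noteq> v"
    | "\<And>v. v \<in> V \<Longrightarrow> \<phi> g v \<noteq> v" "\<And>v. v \<in> V \<Longrightarrow> \<phi> h v \<noteq> v"
    by blast
  then show "power_alternative r w G g h"
  proof cases
    case 1
    then show ?thesis using power_alternative_elliptic[OF gh(1) _ _ gh(2)] by blast
  next
    case 2
    then show ?thesis using power_alternative_mixed[OF gh(1) 2(1,2) gh(2)] by blast
  next
    case 3
    then show ?thesis 
      using power_alternative_mixed[OF gh(2) 3(1,2) gh(1)] power_alternative_commute[of r w G g h] by blast
  next
    case 4
    then show ?thesis using power_alternative_hyperbolic[OF gh(1) _ gh(2)] by blast
  qed
qed

end

theorem corollary4p8: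
  fixes G :: "('g, 'm) monoid_scheme"
    and V :: "'v set" and E :: "'v set set"
    and \<phi> :: "'g \<Rightarrow> 'v \<Rightarrow> 'v"
    and r :: nat and w :: "nat letter list"
  assumes "w \<in> carrier (free_group_rank r)" and "w \<noteq> \<one>\<^bsub>free_group_rank r\<^esub>"
    and "group G"
    and "simplicial_tree V E"
    and "acts_by_graph_automorphisms G V E \<phi>"
    and "without_inversions G E \<phi>"
    and "stabilisation_property G V E \<phi>"
    and "\<And>z C. z \<in> carrier G \<Longrightarrow> C \<in> vertex_stabiliser_intersections G V \<phi> \<Longrightarrow>
           C \<lhd> subgroup_generated G (insert z C) \<Longrightarrow>
           law_power_alternative r w (subgroup_generated G (insert z C))"
  shows "law_power_alternative r w G"
proof -
  interpret simplicial_tree V E by fact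
  interpret group_action G V \<phi> using assms(5) by (simp add: acts_by_graph_automorphisms_def)
  interpret law_tree_action G V E \<phi> r w
  proof
    show "{\<phi> g u, \<phi> g v} \<in> E \<longleftrightarrow> {u, v} \<in> E" if "g \<in> carrier G" "u \<in> V" "v \<in> V" for g u v
      using assms(5) that by (simp add: acts_by_graph_automorphisms_def)
    show "\<phi> g v \<noteq> u" if "g \<in> carrier G" "{u, v} \<in> E" "\<phi> g u = v" for g u v
      using assms(6) that unfolding without_inversions_def by blast
  qed (use assms(7,8) in auto)
  show ?thesis by (rule law_power_alternative)
qed

end
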